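(* Let $F_\theta$ be a member of the exponential-type parametric family with bounded support ($x_F<\infty$), satisfying the bounded endpoint regularity condition with constants $c_-,c_-'\ge 0$. For each $n$, let $\tau^*$ be the optimal full-information stopping rule for $X_1,\dots,X_n$ i.i.d. from $F_\theta$. Then, as $n\to\infty$, $$\mathbb E_\theta[X_{\tau^*}]=x_F-\left(\frac{\theta+c_-}{\theta}\right)^{c_-/\theta}\bar\psi\!\left(\frac{\log n}{\theta}\right)(1+o(1)),$$ $$\mathrm{OPT}(\theta)=x_F-\Gamma\!\left(1+\frac{c_-}{\theta}\right)\bar\psi\!\left(\frac{\log n}{\theta}\right)(1+o(1)),$$ and, since $\bar\psi(\log n/\theta)\to0$, $$\lim_{n\to\infty}\mathrm{CR}_n(\tau^*;\theta)=1.$$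
   Context: Exponential-type parametric family: $\theta>0$, $0\le x_0<x_F\le\infty$, and $\phi:[x_0,x_F)\to[0,\infty)$ is a strictly increasing function with $\phi(x_0)=0$ and $\phi(x)\to\infty$ as $x\uparrow x_F$, with inverse $\psi:=\phi^{-1}:[0,\infty)\to[x_0,x_F)$ (so $\phi$ is a bijection). The CDF is $F_\theta(x)=0$ for $x<x_0$, $F_\theta(x)=1-\exp(-\theta\phi(x))$ for $x_0\le x<x_F$, and $F_\theta(x)=1$ for $x\ge x_F$. Bounded endpoint regularity condition: $x_F<\infty$, $\psi$ is eventually (i.e. for all large arguments) twice differentiable, and with $\bar\psi(y):=x_F-\psi(y)$ there exist constants $c_-,c_-'\in[0,\infty)$ with $\lim_{y\to\infty}\bar\psi'(y)/\bar\psi(y)=-c_-$ and $\lim_{y\to\infty}\bar\psi''(y)/\bar\psi'(y)=-c_-'$. Stopping problem: $X_1,\dots,X_n$ are i.i.d. from $F_\theta$; $X_{n+1}:=0$. A policy is a stopping time $\tau\in\{1,\dots,n\}\cup\{n+1\}$ adapted to the sequentially observed $(X_t)$, with reward $X_\tau$. $\mathrm{OPT}(\theta):=\mathbb E_\theta[\max_{t\in[n]}X_t]$ and $\mathrm{CR}_n(\tau;\theta):=\mathbb E_\theta[X_\tau]/\mathrm{OPT}(\theta)$. The optimal full-information stopping rule $\tau^*$ is the stopping time maximizing $\mathbb E_\theta[X_\tau]$ when $\theta$ (hence $F_\theta$) is known. $\Gamma$ is the Gamma function. *)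

theory Defs
  imports "HOL-Probability.Probability"
begin

section \<open>The exponential-type family\<close>

definition supp :: "real \<Rightarrow> ereal \<Rightarrow> real set" where
  "supp x0 xF = {x. x0 \<le> x \<and> ereal x < xF}"

definition exp_type_family :: "real \<Rightarrow> real \<Rightarrow> ereal \<Rightarrow> (real \<Rightarrow> real) \<Rightarrow> bool" where
  "exp_type_family \<theta> x0 xF \<phi> \<longleftrightarrow>
     0 < \<theta> \<and> 0 \<le> x0 \<and> ereal x0 < xF \<and>
     strict_mono_on (supp x0 xF) \<phi> \<and> \<phi> x0 = 0 \<and>
     filterlim (\<lambda>x. \<phi> (real_of_ereal x)) at_top (at_left xF) \<and>
     bij_betw \<phi> (supp x0 xF) {0..}"

definition exp_type_cdf :: "real \<Rightarrow> real \<Rightarrow> ereal \<Rightarrow> (real \<Rightarrow> real) \<Rightarrow> real \<Rightarrow> real" where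
  "exp_type_cdf \<theta> x0 xF \<phi> x =
     (if x < x0 then 0 else if ereal x < xF then 1 - exp (- \<theta> * \<phi> x) else 1)"

text \<open>Only the values of \<open>psi\<close> on \<open>[0,\<infinity>)\<close> are meaningful.\<close>

definition psi :: "real \<Rightarrow> ereal \<Rightarrow> (real \<Rightarrow> real) \<Rightarrow> real \<Rightarrow> real" where
  "psi x0 xF \<phi> = inv_into (supp x0 xF) \<phi>"

definition psi_bar :: "real \<Rightarrow> real \<Rightarrow> (real \<Rightarrow> real) \<Rightarrow> real \<Rightarrow> real" where
  "psi_bar x0 xF \<phi> y = xF - psi x0 (ereal xF) \<phi> y"

text \<open>The endpoint \<open>xF\<close> is a real number here, so it is finite. The convention \<open>a / 0 = 0\<close> is
  harmless in the second limit: boundedness of the quotient of the second by the first derivative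
  near infinity forces the first derivative of the strictly decreasing function \<open>psi_bar\<close> to be
  eventually nonzero.\<close>

definition bounded_endpoint_regular ::
  "real \<Rightarrow> real \<Rightarrow> (real \<Rightarrow> real) \<Rightarrow> real \<Rightarrow> real \<Rightarrow> bool" where
  "bounded_endpoint_regular x0 xF \<phi> c c' \<longleftrightarrow>
     (let \<psi> = psi x0 (ereal xF) \<phi>; \<psi>b = psi_bar x0 xF \<phi> in
       (\<forall>\<^sub>F y in at_top. \<psi> differentiable (at y) \<and> deriv \<psi> differentiable (at y)) \<and>
       0 \<le> c \<and> 0 \<le> c' \<and>
       ((\<lambda>y. deriv \<psi>b y / \<psi>b y) \<longlongrightarrow> - c) at_top \<and>
       ((\<lambda>y. deriv (deriv \<psi>b) y / deriv \<psi>b y) \<longlongrightarrow> - c') at_top)"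

section \<open>The stopping problem\<close>

definition iid_sample ::
  "'a measure \<Rightarrow> (nat \<Rightarrow> 'a \<Rightarrow> real) \<Rightarrow> nat \<Rightarrow> (real \<Rightarrow> real) \<Rightarrow> bool" where
  "iid_sample M X n F \<longleftrightarrow>
     prob_space M \<and> prob_space.indep_vars M (\<lambda>_. borel) X {1..n} \<and>
     (\<forall>t\<in>{1..n}. \<forall>x. cdf (distr M borel (X t)) x = F x)"

text \<open>The sigma-algebra generated by the observations made up to time \<open>t\<close>; nothing new is
  observed after time \<open>n\<close>.\<close>

definition obs_filtration ::
  "'a measure \<Rightarrow> (nat \<Rightarrow> 'a \<Rightarrow> real) \<Rightarrow> nat \<Rightarrow> nat \<Rightarrow> 'a measure" where
  "obs_filtration M X n t =
     sigma (space M) (\<Union>i\<in>{1..min t n}. {X i -` B \<inter> space M | B. B \<in> sets borel})"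

definition policies :: "'a measure \<Rightarrow> (nat \<Rightarrow> 'a \<Rightarrow> real) \<Rightarrow> nat \<Rightarrow> ('a \<Rightarrow> nat) set" where
  "policies M X n =
     {\<tau>. stopping_time (obs_filtration M X n) \<tau> \<and> (\<forall>\<omega>\<in>space M. \<tau> \<omega> \<in> {1..n} \<union> {n + 1})}"

text \<open>The value \<open>\<tau> \<omega> = n + 1\<close> means that no observation is accepted, with reward \<open>0\<close>.\<close>

definition expected_reward ::
  "'a measure \<Rightarrow> (nat \<Rightarrow> 'a \<Rightarrow> real) \<Rightarrow> nat \<Rightarrow> ('a \<Rightarrow> nat) \<Rightarrow> real" where
  "expected_reward M X n \<tau> = (\<integral>\<omega>. (if \<tau> \<omega> = n + 1 then 0 else X (\<tau> \<omega>) \<omega>) \<partial>M)"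

definition OPT :: "'a measure \<Rightarrow> (nat \<Rightarrow> 'a \<Rightarrow> real) \<Rightarrow> nat \<Rightarrow> real" where
  "OPT M X n = (\<integral>\<omega>. Max ((\<lambda>t. X t \<omega>) ` {1..n}) \<partial>M)"

definition CR :: "'a measure \<Rightarrow> (nat \<Rightarrow> 'a \<Rightarrow> real) \<Rightarrow> nat \<Rightarrow> ('a \<Rightarrow> nat) \<Rightarrow> real" where
  "CR M X n \<tau> = expected_reward M X n \<tau> / OPT M X n"

definition optimal_rule :: "'a measure \<Rightarrow> (nat \<Rightarrow> 'a \<Rightarrow> real) \<Rightarrow> nat \<Rightarrow> ('a \<Rightarrow> nat) \<Rightarrow> bool" where
  "optimal_rule M X n \<tau> \<longleftrightarrow>
     \<tau> \<in> policies M X n \<and>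
     (\<forall>\<sigma>\<in>policies M X n. expected_reward M X n \<sigma> \<le> expected_reward M X n \<tau>)"

end

theory Submission
  imports Defs
begin

text \<open>Write \<open>Y = xF - X\<close>, let \<open>Q\<close> be the distribution function of \<open>Y\<close>, \<open>p\<close> the function
  \<open>psi_bar\<close> and \<open>L n = p (ln n / \<theta>)\<close>, so that \<open>Q (L n) = 1 / n\<close>. Integrating \<open>(ln p)' \<rightarrow> - c\<close>
  gives \<open>p (u + s) / p u \<rightarrow> exp (- c s)\<close>, hence \<open>n Q (z L n) \<rightarrow> z powr (\<theta> / c)\<close> (for \<open>c = 0\<close>
  the limit is \<open>0\<close> or \<open>\<infinity>\<close> according to \<open>z < 1\<close> or \<open>z > 1\<close>).

  The prophet loses the integral of \<open>(1 - Q) ^ n\<close>; rescaling by \<open>L n\<close> and dominated convergence turn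
  it into the integral of \<open>exp (- (z powr (\<theta> / c)))\<close>, or of the indicator of \<open>[0, 1]\<close> if \<open>c = 0\<close>,
  which is \<open>\<Gamma> (1 + c / \<theta>)\<close>.

  By backward induction the optimal rule loses \<open>w n\<close>, where \<open>w 0 = xF\<close> and
  \<open>w (n + 1) = w n - gain (w n)\<close> with \<open>gain v\<close> the integral of \<open>Q\<close> over \<open>[0, v]\<close>. As
  \<open>v - gain v\<close> is increasing in \<open>v\<close>, the sequence \<open>w\<close> can be compared with \<open>\<rho> L n\<close>, which
  satisfies the recursion as an inequality in one direction or the other according to whether \<open>\<rho>\<close>
  is above or below \<open>((\<theta> + c) / \<theta>) powr (c / \<theta>)\<close>. Only for \<open>c = 0\<close> and \<open>\<rho> < 1\<close> does this fail;
  there \<open>w n \<ge> b (1 - Q b) ^ n\<close> with \<open>b = \<rho> L n\<close> suffices.\<close>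

section \<open>Limits and integrals\<close>

text \<open>The exponential series dominates each of its terms. This trades exponential decay for
  decay of any prescribed polynomial order.\<close>

lemma exp_minus_le_fact_div_power:
  fixes a :: real
  assumes "0 < a"
  shows "exp (- a) \<le> fact m / a ^ m"
proof -
  have "a ^ m /\<^sub>R fact m \<le> (\<Sum>k. a ^ k /\<^sub>R fact k)"
    using sum_le_suminf[OF summable_exp_generic[of a], of "{m}"] assms by simp
  then have "a ^ m / fact m \<le> exp a"
    by (simp add: exp_def divide_inverse mult.commute)
  then show ?thesis
    using assms by (simp add: exp_minus field_simps)
qed

lemma one_minus_power_le_exp:
  fixes q :: real
  assumes "0 \<le> q" "q \<le> 1"
  shows "(1 - q) ^ n \<le> exp (- (real n * q))"
proof -
  have "(1 - q) ^ n \<le> exp (- q) ^ n"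
    using assms exp_ge_add_one_self[of "- q"] by (intro power_mono) auto
  also have "\<dots> = exp (- (real n * q))"
    by (simp flip: exp_of_nat_mult)
  finally show ?thesis .
qed

lemma tendsto_0_if_real_mult_tendsto:
  fixes a :: "nat \<Rightarrow> real"
  assumes "(\<lambda>n. real n * a n) \<longlonglongrightarrow> l"
  shows "a \<longlonglongrightarrow> 0"
proof (rule Lim_transform_eventually)
  have "(\<lambda>n. (real n * a n) * (1 / real n)) \<longlonglongrightarrow> l * 0"
    by (intro tendsto_mult assms lim_1_over_n)
  then show "(\<lambda>n. (real n * a n) * (1 / real n)) \<longlonglongrightarrow> 0" by simp
  show "\<forall>\<^sub>F n in sequentially. (real n * a n) * (1 / real n) = a n"
    using eventually_gt_at_top[of 0] by eventually_elim simp
qed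

text \<open>After taking logarithms, the error \<open>n * (ln (1 - a n) + a n)\<close> is at most
  \<open>2 * |n * a n| * |a n|\<close>, a bounded factor times a null sequence.\<close>

lemma tendsto_exp_limit_sequence:
  fixes a :: "nat \<Rightarrow> real"
  assumes lim: "(\<lambda>n. real n * a n) \<longlonglongrightarrow> l"
  shows "(\<lambda>n. (1 - a n) ^ n) \<longlonglongrightarrow> exp (- l)"
proof -
  have a0: "a \<longlonglongrightarrow> 0"
    using lim by (rule tendsto_0_if_real_mult_tendsto)
  have ev: "\<forall>\<^sub>F n in sequentially. \<bar>a n\<bar> < 1 / 2"
    using order_tendstoD[OF tendsto_rabs[OF a0], of "1/2"] by simp
  have "(\<lambda>n. real n * ln (1 - a n)) \<longlonglongrightarrow> - l"
  proof (rule Lim_transform)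
    show "(\<lambda>n. - (real n * a n)) \<longlonglongrightarrow> - l"
      by (intro tendsto_intros lim)
    show "(\<lambda>n. real n * ln (1 - a n) - - (real n * a n)) \<longlonglongrightarrow> 0"
    proof (rule Lim_null_comparison)
      show "\<forall>\<^sub>F n in sequentially. norm (real n * ln (1 - a n) - - (real n * a n))
          \<le> 2 * (\<bar>real n * a n\<bar> * \<bar>a n\<bar>)"
        using ev
      proof eventually_elim
        case (elim n)
        have "\<bar>ln (1 + - a n) - - a n\<bar> \<le> 2 * (- a n)\<^sup>2"
          using elim by (intro abs_ln_one_plus_x_minus_x_bound) auto
        then have "real n * \<bar>ln (1 - a n) + a n\<bar> \<le> real n * (2 * (a n)\<^sup>2)"
          by (intro mult_left_mono) auto
        moreover have "norm (real n * ln (1 - a n) - - (real n * a n)) = real n * \<bar>ln (1 - a n) + a n\<bar>"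
        proof -
          have "real n * ln (1 - a n) - - (real n * a n) = real n * (ln (1 - a n) + a n)"
            by (simp add: algebra_simps)
          then show ?thesis by (simp only: real_norm_def abs_mult abs_of_nat)
        qed
        ultimately show ?case
          by (simp add: abs_mult power2_eq_square algebra_simps)
      qed
      have "(\<lambda>n. 2 * (\<bar>real n * a n\<bar> * \<bar>a n\<bar>)) \<longlonglongrightarrow> 2 * (\<bar>l\<bar> * \<bar>0\<bar>)"
        by (intro tendsto_intros lim a0)
      then show "(\<lambda>n. 2 * (\<bar>real n * a n\<bar> * \<bar>a n\<bar>)) \<longlonglongrightarrow> 0" by simp
    qed
  qed
  then have "(\<lambda>n. exp (real n * ln (1 - a n))) \<longlonglongrightarrow> exp (- l)"
    by (rule tendsto_exp)
  then show ?thesis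
  proof (rule Lim_transform_eventually)
    show "\<forall>\<^sub>F n in sequentially. exp (real n * ln (1 - a n)) = (1 - a n) ^ n"
      using ev by eventually_elim (simp add: exp_of_nat_mult)
  qed
qed

text \<open>The substitution \<open>z = t powr a\<close> carries Euler's integral for
  \<open>a * Gamma a\<close> into this one.\<close>

lemma has_bochner_integral_exp_neg_powr:
  fixes a :: real
  assumes "0 < a"
  shows "has_bochner_integral lborel (\<lambda>z. indicator {0<..} z * exp (- (z powr (1 / a)))) (Gamma (1 + a))"
proof -
  have Gamma_Suc: "Gamma (1 + a) = a * Gamma a"
    using assms Gamma_plus1[of a] nonpos_Ints_nonpos[of a] by (force simp: add.commute)
  define f where "f = (\<lambda>z::real. exp (- (z powr (1 / a))))"
  have img: "(\<lambda>t. t powr a) ` {0<..} = {0<..}"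
  proof (intro set_eqI iffI)
    fix z :: real assume "z \<in> {0<..}"
    then have "z = (z powr (1 / a)) powr a" "z powr (1 / a) \<in> {0<..}"
      using assms by (auto simp: powr_powr)
    then show "z \<in> (\<lambda>t. t powr a) ` {0<..}" by blast
  qed auto
  have inj: "inj_on (\<lambda>t. t powr a) {0<..}"
    using assms by (intro inj_on_inverseI[where g = "\<lambda>z. z powr (1 / a)"]) (auto simp: powr_powr)
  have "((\<lambda>t. t powr (a - 1) / exp t) has_integral Gamma a) {0..}"
    using Gamma_integral_real[OF assms] .
  \<comment> \<open>The point \<open>0\<close> is dropped because the substitution map need not be
    differentiable there.\<close>
  then have "((\<lambda>t. t powr (a - 1) / exp t) has_integral Gamma a) {0<..}"
    by (subst (asm) has_integral_spike_set_eq[where T = "{0<..}"])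
      (auto intro: negligible_subset[of "{0}"])
  then have "((\<lambda>t. a * (t powr (a - 1) / exp t)) has_integral a * Gamma a) {0<..}"
    by (rule has_integral_mult_right)
  then have G: "((\<lambda>t. \<bar>a * t powr (a - 1)\<bar> * f (t powr a)) has_integral Gamma (1 + a)) {0<..}"
    using assms
    by (elim has_integral_eq_rhs[OF has_integral_eq, rotated])
      (auto simp: f_def powr_powr exp_minus divide_inverse Gamma_Suc)
  have "(\<lambda>t. \<bar>a * t powr (a - 1)\<bar> * f (t powr a)) absolutely_integrable_on {0<..} \<and>
      integral {0<..} (\<lambda>t. \<bar>a * t powr (a - 1)\<bar> * f (t powr a)) = Gamma (1 + a)"
    using G by (auto intro!: nonnegative_absolutely_integrable_1 simp: f_def integral_unique has_integral_integrable)
  then have "f absolutely_integrable_on {0<..} \<and> integral {0<..} f = Gamma (1 + a)"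
    by (subst (asm) has_absolute_integral_change_of_variables_1'[where g = "\<lambda>t. t powr a"])
      (use assms inj in \<open>auto intro!: derivative_eq_intros simp: img\<close>)
  then have int: "set_integrable lebesgue {0<..} f" and val: "set_lebesgue_integral lebesgue {0<..} f = Gamma (1 + a)"
    by (auto simp: set_lebesgue_integral_eq_integral(2))
  have m: "(\<lambda>z. indicator {0<..} z * f z) \<in> borel_measurable borel"
    unfolding f_def by measurable
  show ?thesis
    using int val m
    unfolding set_integrable_def set_lebesgue_integral_def has_bochner_integral_iff f_def
    by (simp add: integrable_completion integral_completion)
qed

lemma integrable_indicator_times_bounded:
  fixes g :: "real \<Rightarrow> real"
  assumes [measurable]: "g \<in> borel_measurable borel" and "\<And>x. \<bar>g x\<bar> \<le> B"
  shows "integrable lborel (\<lambda>x. indicator {a..b} x * g x)"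
proof (rule Bochner_Integration.integrable_bound)
  show "integrable lborel (\<lambda>x. indicator {a..b} x * B)"
    by (cases "a \<le> b") (auto intro!: integrable_real_mult_indicator)
  show "AE x in lborel. norm (indicator {a..b} x * g x) \<le> norm (indicator {a..b} x * B)"
    using assms(2) by (auto simp: indicator_def intro: order_trans[OF _ abs_ge_self])
qed measurable

lemma integral_indicator_interval_scale:
  fixes g :: "real \<Rightarrow> real"
  assumes "0 < l"
  shows "(\<integral>y. indicator {0..b} y * g y \<partial>lborel) = l * (\<integral>z. indicator {0..b / l} z * g (z * l) \<partial>lborel)"
proof -
  have "(\<integral>y. indicator {0..b} y * g y \<partial>lborel)
      = \<bar>l\<bar> *\<^sub>R (\<integral>z. indicator {0..b} (0 + l * z) * g (0 + l * z) \<partial>lborel)"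
    using assms by (intro lborel_integral_real_affine) simp
  also have "(\<lambda>z. indicator {0..b} (0 + l * z) * g (0 + l * z)) = (\<lambda>z. indicator {0..b / l} z * g (z * l))"
    using assms by (auto simp: fun_eq_iff indicator_def field_simps zero_le_mult_iff)
  finally show ?thesis
    using assms by simp
qed

section \<open>Asymptotics of the two losses\<close>

text \<open>Here \<open>p\<close> stands for \<open>psi_bar\<close> and \<open>Q\<close> for the
  distribution function of \<open>xF - X\<close>. The two are linked only by \<open>Q_p\<close>, at
  the points \<open>p s\<close>; elsewhere the monotonicity of \<open>Q\<close> has to do the
  work.\<close>

locale endpoint_law =
  fixes \<theta> c xF :: real and p Q :: "real \<Rightarrow> real"
  assumes theta_pos: "0 < \<theta>"
    and c_nonneg: "0 \<le> c"
    and p_pos: "0 \<le> y \<Longrightarrow> 0 < p y"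
    and p_le: "0 \<le> y \<Longrightarrow> p y \<le> xF"
    and p_antimono: "0 \<le> y \<Longrightarrow> y \<le> z \<Longrightarrow> p z \<le> p y"
    and p_tendsto_0: "(p \<longlongrightarrow> 0) at_top"
    and p_differentiable: "\<forall>\<^sub>F y in at_top. p differentiable (at y)"
    and p_log_deriv: "((\<lambda>y. deriv p y / p y) \<longlongrightarrow> - c) at_top"
    and Q_mono: "y \<le> z \<Longrightarrow> Q y \<le> Q z"
    and Q_nonneg: "0 \<le> Q y"
    and Q_le_1: "Q y \<le> 1"
    and Q_p: "0 \<le> s \<Longrightarrow> Q (p s) = exp (- \<theta> * s)"
begin

section \<open>Logarithmic increments of \<open>p\<close>\<close>

lemma xF_pos: "0 < xF"
  using p_pos[of 0] p_le[of 0] by simp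

lemma Q_measurable [measurable]: "Q \<in> borel_measurable borel"
  by (rule borel_measurable_mono) (auto intro: monoI Q_mono)

text \<open>Mean value theorem for \<open>ln (p y)\<close>, whose derivative
  \<open>deriv p y / p y\<close> is eventually within \<open>\<epsilon>\<close> of
  \<open>- c\<close>. The order of \<open>a\<close> and \<open>b\<close> is left open because shifts
  of both signs occur later.\<close>

lemma log_increment:
  assumes "0 < \<epsilon>"
  obtains y0 where "0 \<le> y0"
    "\<And>a b. y0 \<le> a \<Longrightarrow> y0 \<le> b \<Longrightarrow> \<bar>ln (p b) - ln (p a) + c * (b - a)\<bar> \<le> \<epsilon> * \<bar>b - a\<bar>"
proof -
  have "\<forall>\<^sub>F y in at_top. \<bar>deriv p y / p y + c\<bar> < \<epsilon>"
    using tendstoD[OF p_log_deriv assms] by (simp add: dist_real_def)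
  then have "\<forall>\<^sub>F y in at_top. p differentiable (at y) \<and> \<bar>deriv p y / p y + c\<bar> < \<epsilon>"
    using p_differentiable by eventually_elim simp
  then obtain y1 where y1: "\<And>y. y1 \<le> y \<Longrightarrow> p differentiable (at y) \<and> \<bar>deriv p y / p y + c\<bar> < \<epsilon>"
    unfolding eventually_at_top_linorder by blast
  have main: "\<bar>ln (p b) - ln (p a) + c * (b - a)\<bar> \<le> \<epsilon> * (b - a)"
    if "max 0 y1 \<le> a" "a < b" for a b
  proof -
    have "((\<lambda>y. ln (p y)) has_real_derivative deriv p y / p y) (at y)" if "a \<le> y" for y
      using that \<open>max 0 y1 \<le> a\<close> y1[of y] p_pos[of y]
      by (auto intro!: derivative_eq_intros DERIV_deriv_iff_real_differentiable[THEN iffD2]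
          simp: field_simps)
    from MVT2[OF \<open>a < b\<close> this] obtain \<xi> where \<xi>: "a < \<xi>" "\<xi> < b"
      "ln (p b) - ln (p a) = (b - a) * (deriv p \<xi> / p \<xi>)" by auto
    then have "ln (p b) - ln (p a) + c * (b - a) = (deriv p \<xi> / p \<xi> + c) * (b - a)"
      by (simp add: algebra_simps)
    then have "\<bar>ln (p b) - ln (p a) + c * (b - a)\<bar> = \<bar>deriv p \<xi> / p \<xi> + c\<bar> * (b - a)"
      using that by (simp add: abs_mult)
    then show ?thesis
      using y1[of \<xi>] \<xi> that by (auto intro!: mult_right_mono)
  qed
  show thesis
  proof (rule that)
    show "0 \<le> max 0 y1" by simp
    fix a b assume ab: "max 0 y1 \<le> a" "max 0 y1 \<le> b"
    consider "a < b" | "a = b" | "b < a" by linarith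
    then show "\<bar>ln (p b) - ln (p a) + c * (b - a)\<bar> \<le> \<epsilon> * \<bar>b - a\<bar>"
    proof cases
      case 3
      have "\<bar>ln (p b) - ln (p a) + c * (b - a)\<bar> = \<bar>ln (p a) - ln (p b) + c * (a - b)\<bar>"
        by (simp add: abs_if algebra_simps)
      then show ?thesis using main[of b a] ab 3 by simp
    qed (use main[of a b] ab in auto)
  qed
qed

text \<open>In multiplicative terms, \<open>p (ln t)\<close> varies regularly with index
  \<open>- c\<close>, and slowly if \<open>c = 0\<close>.\<close>

lemma shift_ratio: "((\<lambda>u. p (u + s) / p u) \<longlongrightarrow> exp (- c * s)) at_top"
proof -
  have "((\<lambda>u. ln (p (u + s)) - ln (p u)) \<longlongrightarrow> - c * s) at_top"
  proof (rule tendstoI)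
    fix r :: real assume "0 < r"
    \<comment> \<open>The summand \<open>1\<close> keeps the quotient meaningful for
      \<open>s = 0\<close> and makes \<open>\<epsilon> * |s| < r\<close> strict.\<close>
    define \<epsilon> where "\<epsilon> = r / (\<bar>s\<bar> + 1)"
    have "0 < \<epsilon>" and less: "\<epsilon> * \<bar>s\<bar> < r"
      using \<open>0 < r\<close> by (auto simp: \<epsilon>_def field_simps)
    from log_increment[OF \<open>0 < \<epsilon>\<close>] obtain y0 where y0: "0 \<le> y0"
      "\<And>a b. y0 \<le> a \<Longrightarrow> y0 \<le> b \<Longrightarrow> \<bar>ln (p b) - ln (p a) + c * (b - a)\<bar> \<le> \<epsilon> * \<bar>b - a\<bar>"
      by blast
    show "\<forall>\<^sub>F u in at_top. dist (ln (p (u + s)) - ln (p u)) (- c * s) < r"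
      using eventually_ge_at_top[of "y0 + \<bar>s\<bar>"]
    proof eventually_elim
      case (elim u)
      then have "\<bar>ln (p (u + s)) - ln (p u) + c * s\<bar> \<le> \<epsilon> * \<bar>s\<bar>"
        using y0(2)[of u "u + s"] abs_ge_self[of s] abs_ge_minus_self[of s] by simp
      then show ?case
        using less by (simp add: dist_real_def)
    qed
  qed
  then have "((\<lambda>u. exp (ln (p (u + s)) - ln (p u))) \<longlongrightarrow> exp (- c * s)) at_top"
    by (rule tendsto_exp)
  then show ?thesis
  proof (rule Lim_transform_eventually)
    show "\<forall>\<^sub>F u in at_top. exp (ln (p (u + s)) - ln (p u)) = p (u + s) / p u"
      using eventually_ge_at_top[of "\<bar>s\<bar>"]
      by eventually_elim (auto simp: exp_diff p_pos)
  qed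
qed

section \<open>The tail \<open>Q\<close> at the scale \<open>L n\<close>\<close>

definition L :: "nat \<Rightarrow> real" where
  "L n = p (ln (real n) / \<theta>)"

lemma log_scale_at_top: "filterlim (\<lambda>n. ln (real n) / \<theta>) at_top sequentially"
  using theta_pos by real_asymp

lemma L_pos: "1 \<le> n \<Longrightarrow> 0 < L n"
  using theta_pos by (simp add: L_def p_pos)

lemma L_tendsto_0: "L \<longlonglongrightarrow> 0"
  unfolding L_def by (rule filterlim_compose[OF p_tendsto_0 log_scale_at_top])

text \<open>By \<open>shift_ratio\<close>, \<open>z * L n\<close> is eventually below
  \<open>p (ln n / \<theta> + s)\<close>, a point where \<open>Q\<close> is known to equal
  \<open>exp (- \<theta> * s) / n\<close>. For \<open>c = 0\<close> the hypothesis reads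
  \<open>z < 1\<close> and leaves \<open>s\<close> free.\<close>

lemma tail_upper:
  assumes "z < exp (- c * s)"
  shows "\<forall>\<^sub>F n in sequentially. real n * Q (z * L n) \<le> exp (- \<theta> * s)"
proof -
  have "\<forall>\<^sub>F u in at_top. z < p (u + s) / p u"
    using order_tendstoD(1)[OF shift_ratio assms] .
  then have "\<forall>\<^sub>F n in sequentially. z < p (ln (real n) / \<theta> + s) / L n"
    unfolding L_def by (rule eventually_compose_filterlim[OF _ log_scale_at_top])
  \<comment> \<open>\<open>Q_p\<close> is available at nonnegative arguments only, and
    \<open>s\<close> may be negative.\<close>
  moreover have "\<forall>\<^sub>F n in sequentially. - s \<le> ln (real n) / \<theta>"
    using log_scale_at_top by (rule filterlim_at_top[THEN iffD1, rule_format])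
  ultimately show ?thesis
    using eventually_ge_at_top[of 1]
  proof eventually_elim
    case (elim n)
    then have "Q (z * L n) \<le> Q (p (ln (real n) / \<theta> + s))"
      using L_pos[of n] by (intro Q_mono) (simp add: field_simps)
    also have "\<dots> = exp (- ln (real n) - \<theta> * s)"
      using elim theta_pos by (subst Q_p) (auto simp: algebra_simps)
    also have "\<dots> = exp (- \<theta> * s) / real n"
      using elim by (simp add: exp_diff exp_minus field_simps)
    finally show ?case
      using elim by (simp add: field_simps)
  qed
qed

lemma tail_lower:
  assumes "exp (- c * s) < z"
  shows "\<forall>\<^sub>F n in sequentially. exp (- \<theta> * s) \<le> real n * Q (z * L n)"
proof -
  have "\<forall>\<^sub>F u in at_top. p (u + s) / p u < z"
    using order_tendstoD(2)[OF shift_ratio assms] .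
  then have "\<forall>\<^sub>F n in sequentially. p (ln (real n) / \<theta> + s) / L n < z"
    unfolding L_def by (rule eventually_compose_filterlim[OF _ log_scale_at_top])
  moreover have "\<forall>\<^sub>F n in sequentially. - s \<le> ln (real n) / \<theta>"
    using log_scale_at_top by (rule filterlim_at_top[THEN iffD1, rule_format])
  ultimately show ?thesis
    using eventually_ge_at_top[of 1]
  proof eventually_elim
    case (elim n)
    then have "Q (p (ln (real n) / \<theta> + s)) \<le> Q (z * L n)"
      using L_pos[of n] by (intro Q_mono) (simp add: field_simps)
    moreover have "Q (p (ln (real n) / \<theta> + s)) = exp (- ln (real n) - \<theta> * s)"
      using elim theta_pos by (subst Q_p) (auto simp: algebra_simps)
    moreover have "exp (- ln (real n) - \<theta> * s) = exp (- \<theta> * s) / real n"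
      using elim by (simp add: exp_diff exp_minus field_simps)
    ultimately have "exp (- \<theta> * s) / real n \<le> Q (z * L n)"
      by simp
    then show ?case
      using elim by (simp add: field_simps)
  qed
qed

text \<open>With \<open>s = - ln x / c\<close> the condition in \<open>tail_upper\<close> and
  \<open>tail_lower\<close> compares \<open>x\<close> with \<open>z\<close>, and the bound is
  \<open>x powr (\<theta> / c)\<close>. Letting \<open>x\<close> approach \<open>z\<close> from
  either side and using continuity gives the limit.\<close>

lemma tail_limit:
  assumes "0 < c" "0 < z"
  shows "(\<lambda>n. real n * Q (z * L n)) \<longlonglongrightarrow> z powr (\<theta> / c)"
proof (rule order_tendstoI)
  have cont: "((\<lambda>x. x powr (\<theta> / c)) \<longlongrightarrow> z powr (\<theta> / c)) (at z)"
    using assms by (intro tendsto_intros) auto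
  have exp_ln: "exp (- \<theta> * (- ln x / c)) = x powr (\<theta> / c)" "exp (- c * (- ln x / c)) = x"
    if "0 < x" for x
    using that assms by (auto simp: powr_def)
  fix a
  {
    assume "a < z powr (\<theta> / c)"
    then have "\<forall>\<^sub>F x in at_left z. a < x powr (\<theta> / c)"
      using order_tendstoD(1)[OF tendsto_mono[OF _ cont]] by (metis at_le top_greatest)
    moreover have "\<forall>\<^sub>F x in at_left z. 0 < x \<and> x < z"
      using eventually_at_left_real[OF assms(2)] by simp
    ultimately have "\<forall>\<^sub>F x in at_left z. a < x powr (\<theta> / c) \<and> 0 < x \<and> x < z"
      by eventually_elim simp
    then obtain x where x: "a < x powr (\<theta> / c)" "0 < x" "x < z"
      using eventually_happens[of _ "at_left z"] by (auto simp: trivial_limit_at_left_real)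
    show "\<forall>\<^sub>F n in sequentially. a < real n * Q (z * L n)"
      using tail_lower[of "- ln x / c" z] x exp_ln[of x]
      by (auto elim!: eventually_mono)
  }
  {
    assume "z powr (\<theta> / c) < a"
    then have "\<forall>\<^sub>F x in at_right z. x powr (\<theta> / c) < a"
      using order_tendstoD(2)[OF tendsto_mono[OF _ cont]] by (metis at_le top_greatest)
    moreover have "\<forall>\<^sub>F x in at_right z. z < x"
      by (simp add: eventually_at_right_less)
    ultimately have "\<forall>\<^sub>F x in at_right z. x powr (\<theta> / c) < a \<and> z < x"
      by eventually_elim simp
    then obtain x where x: "x powr (\<theta> / c) < a" "z < x"
      using eventually_happens[of _ "at_right z"] by (auto simp: trivial_limit_at_right_real)
    show "\<forall>\<^sub>F n in sequentially. real n * Q (z * L n) < a"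
      using tail_upper[of z "- ln x / c"] x exp_ln[of x] assms
      by (auto elim!: eventually_mono)
  }
qed

text \<open>For \<open>c = 0\<close> the shift \<open>s\<close> can be chosen at will: large and
  positive when \<open>z < 1\<close>, large and negative when \<open>z > 1\<close>.\<close>

lemma tail_slow:
  assumes "c = 0"
  shows "z < 1 \<Longrightarrow> (\<lambda>n. real n * Q (z * L n)) \<longlonglongrightarrow> 0"
    and "1 < z \<Longrightarrow> filterlim (\<lambda>n. real n * Q (z * L n)) at_top sequentially"
proof -
  assume z: "z < 1"
  show "(\<lambda>n. real n * Q (z * L n)) \<longlonglongrightarrow> 0"
  proof (rule order_tendstoI)
    fix a :: real assume "0 < a"
    \<comment> \<open>The left side is \<open>a / 2\<close>; halving makes the resulting bound
      strict.\<close>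
    then have "exp (- \<theta> * (- ln (a / 2) / \<theta>)) < a"
      using theta_pos by simp
    then show "\<forall>\<^sub>F n in sequentially. real n * Q (z * L n) < a"
      using tail_upper[of z "- ln (a / 2) / \<theta>"] z assms by (auto elim!: eventually_mono)
  next
    fix a :: real assume "a < 0"
    then have "a < real n * Q (z * L n)" for n
      using Q_nonneg[of "z * L n"] mult_nonneg_nonneg[of "real n" "Q (z * L n)"] by linarith
    then show "\<forall>\<^sub>F n in sequentially. a < real n * Q (z * L n)" by simp
  qed
next
  assume z: "1 < z"
  show "filterlim (\<lambda>n. real n * Q (z * L n)) at_top sequentially"
    unfolding filterlim_at_top_gt[where c = 0]
  proof (intro allI impI)
    fix a :: real assume "0 < a"
    then show "\<forall>\<^sub>F n in sequentially. a \<le> real n * Q (z * L n)"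
      using tail_lower[of "- ln a / \<theta>" z] z assms theta_pos by simp
  qed
qed

text \<open>Dominated convergence for the prophet needs growth of \<open>n * Q (z * L n)\<close>
  that is uniform in \<open>n\<close> over the whole range of \<open>z\<close>. Allowing the error
  \<open>1\<close> in \<open>log_increment\<close> bounds the decay rate of \<open>p\<close> by
  \<open>c + 1\<close>; the exponent \<open>\<theta> / (c + 1)\<close> is weaker than
  \<open>\<theta> / c\<close>, but it is positive also for \<open>c = 0\<close>.\<close>

lemma tail_uniform_lower:
  obtains r \<kappa> N where "1 \<le> r" "0 < \<kappa>"
    "\<And>n z. N \<le> n \<Longrightarrow> r \<le> z \<Longrightarrow> z \<le> xF / L n \<Longrightarrow> (z / r) powr \<kappa> \<le> real n * Q (z * L n)"
proof -
  obtain y0 where y0: "0 \<le> y0"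
    "\<And>a b. y0 \<le> a \<Longrightarrow> y0 \<le> b \<Longrightarrow> \<bar>ln (p b) - ln (p a) + c * (b - a)\<bar> \<le> 1 * \<bar>b - a\<bar>"
    using log_increment[of 1] by auto
  have decay: "p a \<le> p b * exp ((c + 1) * (b - a))" if "y0 \<le> a" "a \<le> b" for a b
  proof -
    have "ln (p a) \<le> ln (p b) + (c + 1) * (b - a)"
      using y0(2)[of a b] that by (auto simp: algebra_simps abs_le_iff)
    then have "exp (ln (p a)) \<le> exp (ln (p b) + (c + 1) * (b - a))"
      by simp
    then show ?thesis
      using that y0(1) by (simp add: exp_add p_pos)
  qed
  \<comment> \<open>With this \<open>r\<close>, \<open>z \<le> xF / L n\<close> says
    \<open>z / r \<le> p y0 / p u\<close>. That keeps the backward shift \<open>t\<close> below at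
    most \<open>u - y0\<close>, inside the range of \<open>decay\<close>.\<close>
  define r where "r = xF / p y0"
  have py0: "0 < p y0" using p_pos y0(1) by simp
  have r: "1 \<le> r" using p_le[OF y0(1)] py0 by (simp add: r_def)
  define \<kappa> where "\<kappa> = \<theta> / (c + 1)"
  have \<kappa>: "0 < \<kappa>" using theta_pos c_nonneg by (simp add: \<kappa>_def)
  have "\<forall>\<^sub>F n in sequentially. y0 \<le> ln (real n) / \<theta>"
    using log_scale_at_top by (rule filterlim_at_top[THEN iffD1, rule_format])
  then have "\<forall>\<^sub>F n in sequentially. y0 \<le> ln (real n) / \<theta> \<and> 1 \<le> n"
    using eventually_ge_at_top[of 1] by eventually_elim simp
  then obtain N where N: "\<And>n. N \<le> n \<Longrightarrow> y0 \<le> ln (real n) / \<theta> \<and> 1 \<le> n"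
    unfolding eventually_at_top_linorder by blast
  show thesis
  proof (rule that[OF r \<kappa>])
    fix n z assume n: "N \<le> n" and z: "r \<le> z" "z \<le> xF / L n"
    define u where "u = ln (real n) / \<theta>"
    \<comment> \<open>Going back from \<open>u\<close> by this \<open>t\<close> enlarges
      \<open>p\<close> at most by the factor \<open>exp ((c + 1) * t) = z / r\<close>.\<close>
    define t where "t = ln (z / r) / (c + 1)"
    have u: "y0 \<le> u" "1 \<le> n" using N[OF n] by (auto simp: u_def)
    have Ln: "L n = p u" by (simp add: L_def u_def)
    have pu: "0 < p u" using u y0(1) by (simp add: p_pos)
    have zr: "1 \<le> z / r" using z r by simp
    have exp_t: "exp ((c + 1) * t) = z / r"
      using zr c_nonneg by (simp add: t_def)
    have t0: "0 \<le> t" using zr c_nonneg by (simp add: t_def)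
    have "z / r \<le> p y0 / p u"
      using z(2) py0 pu xF_pos by (simp add: r_def Ln field_simps)
    also have "\<dots> \<le> exp ((c + 1) * (u - y0))"
      using decay[OF order_refl u(1)] pu by (simp add: field_simps)
    finally have "exp ((c + 1) * t) \<le> exp ((c + 1) * (u - y0))"
      using exp_t by simp
    then have "t \<le> u - y0" using c_nonneg by simp
    then have "p (u - t) \<le> p u * (z / r)"
      using decay[of "u - t" u] t0 exp_t by simp
    also have "\<dots> \<le> z * p u"
      using r pu zr mult_left_mono[of 1 r "z * p u"] z by (simp add: field_simps)
    finally have "Q (p (u - t)) \<le> Q (z * L n)"
      unfolding Ln by (rule Q_mono)
    moreover have "Q (p (u - t)) = exp (\<theta> * t) / real n"
      using \<open>t \<le> u - y0\<close> y0(1) u theta_pos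
      by (subst Q_p) (auto simp: u_def right_diff_distrib exp_diff)
    ultimately have "exp (\<theta> * t) \<le> real n * Q (z * L n)"
      using u by (simp add: field_simps)
    moreover have "exp (\<theta> * t) = (z / r) powr \<kappa>"
      using zr r by (auto simp: powr_def t_def \<kappa>_def)
    ultimately show "(z / r) powr \<kappa> \<le> real n * Q (z * L n)" by simp
  qed
qed

section \<open>The one-step gain and the loss recursion\<close>

lemma shift_integrable [simp, intro]: "integrable lborel (\<lambda>y. indicator {a..b} y * Q (y * l))"
  by (rule integrable_indicator_times_bounded[where B = 1])
    (auto simp: Q_nonneg Q_le_1)

lemma Q_integrable [simp, intro]: "integrable lborel (\<lambda>y. indicator {a..b} y * Q y)"
  using shift_integrable[of a b 1] by simp

text \<open>By the layer-cake formula this is the expectation of \<open>max (w - Y) 0\<close>, where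
  \<open>Y\<close> has distribution function \<open>Q\<close>: the expected improvement of a loss
  \<open>w\<close> by one further observation.\<close>

definition gain :: "real \<Rightarrow> real" where
  "gain w = (\<integral>y. indicator {0..w} y * Q y \<partial>lborel)"

lemma gain_diff_bounds:
  assumes "0 \<le> a" "a \<le> b"
  shows "(b - a) * Q a \<le> gain b - gain a" and "gain b - gain a \<le> (b - a) * Q b"
proof -
  have eq: "gain b - gain a = (\<integral>y. indicator {0..b} y * Q y - indicator {0..a} y * Q y \<partial>lborel)"
    unfolding gain_def by (subst Bochner_Integration.integral_diff) auto
  have const: "(b - a) * k = (\<integral>y. indicator {a<..b} y * k \<partial>lborel)" for k
    using assms by simp
  have int: "integrable lborel (\<lambda>y. indicator {a<..b} y * k)" for k :: real
    using assms by (auto intro!: integrable_real_mult_indicator)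
  show "(b - a) * Q a \<le> gain b - gain a"
    unfolding eq const using assms
    by (intro integral_mono int Bochner_Integration.integrable_diff Q_integrable)
      (auto simp: indicator_def intro: Q_mono)
  show "gain b - gain a \<le> (b - a) * Q b"
    unfolding eq const using assms
    by (intro integral_mono int Bochner_Integration.integrable_diff Q_integrable)
      (auto simp: indicator_def intro: Q_mono)
qed

lemma gain_0: "gain 0 = 0"
  unfolding gain_def
  by (rule integral_eq_zero_AE, rule AE_mp[OF AE_lborel_singleton[of 0]]) auto

lemma gain_mono: "0 \<le> a \<Longrightarrow> a \<le> b \<Longrightarrow> gain a \<le> gain b"
  using gain_diff_bounds(1)[of a b] Q_nonneg[of a] mult_nonneg_nonneg[of "b - a" "Q a"] by linarith

text \<open>On the stretch from \<open>a\<close> to \<open>b\<close> the gain rises by at most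
  \<open>(b - a) * Q b\<close>, and \<open>Q b\<close> is at most \<open>1\<close>.\<close>

lemma step_mono:
  assumes "0 \<le> a" "a \<le> b"
  shows "a - gain a \<le> b - gain b"
proof -
  have "(b - a) * Q b \<le> b - a"
    using assms Q_le_1[of b] by (intro mult_left_le) auto
  then show ?thesis using gain_diff_bounds(2)[OF assms] by linarith
qed

lemma gain_le: "0 \<le> w \<Longrightarrow> gain w \<le> w * Q w"
  using gain_diff_bounds(2)[of 0 w] by (simp add: gain_0)

lemma gain_ge: "0 \<le> v \<Longrightarrow> v \<le> w \<Longrightarrow> (w - v) * Q v \<le> gain w"
  using gain_diff_bounds(1)[of v w] gain_mono[of 0 v] by (simp add: gain_0)

lemma gain_nonneg: "0 \<le> w \<Longrightarrow> 0 \<le> gain w"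
  using gain_mono[of 0 w] by (simp add: gain_0)

lemma Q_pos: "0 < y \<Longrightarrow> 0 < Q y"
proof -
  assume "0 < y"
  have "\<forall>\<^sub>F s in at_top. p s < y \<and> 0 \<le> s"
    using order_tendstoD(2)[OF p_tendsto_0 \<open>0 < y\<close>] eventually_ge_at_top[of 0]
    by eventually_elim simp
  then obtain s where "p s < y" "0 \<le> s"
    using eventually_happens'[OF trivial_limit_at_top_linorder] by blast
  then show ?thesis
    using Q_mono[of "p s" y] Q_p[of s] by (metis exp_gt_zero less_le_trans less_imp_le)
qed

text \<open>\<open>gain_le\<close> is strict only where \<open>Q < 1\<close>, which may fail at
  \<open>w\<close> itself. Hence strictness is shown at a smaller point \<open>p s\<close> and
  carried up to \<open>w\<close> by \<open>step_mono\<close>.\<close>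

lemma gain_less:
  assumes "0 < w"
  shows "gain w < w"
proof -
  \<comment> \<open>The condition \<open>1 \<le> s\<close> makes \<open>exp (- \<theta> * s)\<close>
    smaller than \<open>1\<close>.\<close>
  have "\<forall>\<^sub>F s in at_top. p s < w \<and> 0 \<le> s \<and> 1 \<le> s"
    using order_tendstoD(2)[OF p_tendsto_0 assms] eventually_ge_at_top[of 0] eventually_ge_at_top[of 1]
    by eventually_elim simp
  then obtain s where s: "p s < w" "0 \<le> s" "1 \<le> s"
    using eventually_happens'[OF trivial_limit_at_top_linorder] by blast
  have "Q (p s) < 1"
    using s theta_pos by (simp add: Q_p)
  then have "p s * Q (p s) < p s * 1"
    by (rule mult_strict_left_mono) (rule p_pos[OF s(2)])
  then have "gain (p s) < p s"
    using gain_le[of "p s"] p_pos[OF s(2)] by linarith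
  then show ?thesis
    using step_mono[of "p s" w] s p_pos[OF s(2)] by simp
qed

text \<open>The sequence \<open>w\<close> of the overview. It starts at \<open>xF\<close> because
  the reward is \<open>0\<close> when no observation is left.\<close>

primrec loss :: "nat \<Rightarrow> real" where
  "loss 0 = xF"
| "loss (Suc n) = loss n - gain (loss n)"

lemma loss_pos: "0 < loss n"
  by (induction n) (auto simp: xF_pos gain_less)

lemma loss_antimono: "m \<le> n \<Longrightarrow> loss n \<le> loss m"
  by (rule lift_Suc_antimono_le) (use gain_nonneg loss_pos in \<open>auto simp: less_imp_le\<close>)

lemma loss_le_xF: "loss n \<le> xF"
  using loss_antimono[of 0 n] by simp

text \<open>The sequence decreases and is bounded below. A limit \<open>l > 0\<close> would force
  every step to lose at least \<open>(l / 2) * Q (l / 2) > 0\<close>.\<close>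

lemma loss_tendsto_0: "loss \<longlonglongrightarrow> 0"
proof -
  have "decseq loss" by (rule antimonoI) (rule loss_antimono)
  then obtain l where l: "loss \<longlonglongrightarrow> l" "\<And>n. l \<le> loss n"
    using decseq_convergent[of loss 0] loss_pos by (metis less_imp_le)
  have "l = 0"
  proof (rule ccontr)
    assume "l \<noteq> 0"
    moreover have "0 \<le> l"
      using l(1) loss_pos by (intro LIMSEQ_le_const[OF l(1)]) (auto intro: less_imp_le)
    ultimately have "0 < l" by simp
    define g where "g = (l - l / 2) * Q (l / 2)"
    have "0 < g" using \<open>0 < l\<close> Q_pos[of "l / 2"] by (simp add: g_def)
    have "loss (Suc n) \<le> loss n - g" for n
      using gain_ge[of "l / 2" "loss n"] l(2)[of n] \<open>0 < l\<close>
        mult_right_mono[of "l - l / 2" "loss n - l / 2" "Q (l / 2)"] Q_nonneg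
      by (simp add: g_def)
    then have "l \<le> l - g"
      by (intro LIMSEQ_le[OF LIMSEQ_Suc[OF l(1)] tendsto_diff[OF l(1) tendsto_const]]) auto
    then show False using \<open>0 < g\<close> by simp
  qed
  then show ?thesis using l by simp
qed

text \<open>From any level \<open>x \<le> b\<close>, one step removes at most the fraction
  \<open>Q x \<le> Q b\<close> of \<open>x\<close>; by \<open>step_mono\<close> the true sequence
  stays above the one that loses exactly the fraction \<open>Q b\<close>.\<close>

lemma loss_lower:
  assumes "0 \<le> b" "b \<le> xF"
  shows "b * (1 - Q b) ^ n \<le> loss n"
proof (induction n)
  case (Suc n)
  define x where "x = b * (1 - Q b) ^ n"
  have x: "0 \<le> x" "x \<le> b"
    using assms Q_nonneg[of b] Q_le_1[of b]
    by (auto simp: x_def mult_left_le power_le_one)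
  have "x * (1 - Q b) \<le> x - gain x"
    using gain_le[OF x(1)] mult_left_mono[OF Q_mono[OF x(2)] x(1)] by (simp add: algebra_simps)
  also have "\<dots> \<le> loss n - gain (loss n)"
    using step_mono[OF x(1)] Suc by (simp add: x_def)
  finally show ?case by (simp add: x_def mult_ac)
qed (use assms in simp)

section \<open>The rate of decrease of \<open>L\<close>\<close>

lemma L_step: "(\<lambda>n. real n * (1 - L (Suc n) / L n)) \<longlonglongrightarrow> c / \<theta>"
proof -
  \<comment> \<open>\<open>h\<close> is the increment of the argument of \<open>p\<close> and
    \<open>d\<close> the resulting decrease of \<open>ln L\<close>. By \<open>log_increment\<close>,
    \<open>d n\<close> is \<open>c * h n\<close> up to an error small relative to
    \<open>h n\<close>, while \<open>n * h n\<close> tends to \<open>1 / \<theta>\<close>.\<close>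
  define h where "h = (\<lambda>n. (ln (real (Suc n)) - ln (real n)) / \<theta>)"
  define d where "d = (\<lambda>n. ln (L n) - ln (L (Suc n)))"
  have nh: "(\<lambda>n. real n * h n) \<longlonglongrightarrow> 1 / \<theta>"
  proof -
    have "(\<lambda>n. real n * (ln (real (Suc n)) - ln (real n))) \<longlonglongrightarrow> 1"
      by real_asymp
    then show ?thesis
      using tendsto_divide[OF _ tendsto_const[of \<theta>]] theta_pos unfolding h_def by fastforce
  qed
  have h0: "0 \<le> h n" if "1 \<le> n" for n
    using that theta_pos by (simp add: h_def)
  have nd: "(\<lambda>n. real n * d n) \<longlonglongrightarrow> c / \<theta>"
  proof (rule Lim_transform)
    show "(\<lambda>n. c * (real n * h n)) \<longlonglongrightarrow> c / \<theta>"
      using tendsto_mult[OF tendsto_const nh, of c] by simp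
    show "(\<lambda>n. real n * d n - c * (real n * h n)) \<longlonglongrightarrow> 0"
    proof (rule tendstoI)
      fix r :: real assume "0 < r"
      \<comment> \<open>Chosen so that \<open>\<epsilon> * (1 / \<theta>)\<close>, the limit of
        \<open>\<epsilon> * (n * h n)\<close>, is \<open>r / 2\<close>.\<close>
      define \<epsilon> where "\<epsilon> = r * \<theta> / 2"
      have "0 < \<epsilon>" using \<open>0 < r\<close> theta_pos by (simp add: \<epsilon>_def)
      obtain y0 where y0: "0 \<le> y0"
        "\<And>a b. y0 \<le> a \<Longrightarrow> y0 \<le> b \<Longrightarrow> \<bar>ln (p b) - ln (p a) + c * (b - a)\<bar> \<le> \<epsilon> * \<bar>b - a\<bar>"
        using log_increment[OF \<open>0 < \<epsilon>\<close>] by blast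
      have "(\<lambda>n. \<epsilon> * (real n * h n)) \<longlonglongrightarrow> \<epsilon> * (1 / \<theta>)"
        by (intro tendsto_mult tendsto_const nh)
      moreover have "\<epsilon> * (1 / \<theta>) < r" using theta_pos \<open>0 < r\<close> by (simp add: \<epsilon>_def)
      ultimately have "\<forall>\<^sub>F n in sequentially. \<epsilon> * (real n * h n) < r"
        by (rule order_tendstoD(2))
      moreover have "\<forall>\<^sub>F n in sequentially. y0 \<le> ln (real n) / \<theta>"
        using log_scale_at_top by (rule filterlim_at_top[THEN iffD1, rule_format])
      ultimately show "\<forall>\<^sub>F n in sequentially. dist (real n * d n - c * (real n * h n)) 0 < r"
        using eventually_ge_at_top[of 1]
      proof eventually_elim
        case (elim n)
        have hn: "ln (real (Suc n)) / \<theta> - ln (real n) / \<theta> = h n"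
          by (simp add: h_def diff_divide_distrib)
        have "\<bar>- d n + c * h n\<bar> \<le> \<epsilon> * h n"
          using y0(2)[of "ln (real n) / \<theta>" "ln (real (Suc n)) / \<theta>"] elim h0[of n] hn
          by (simp add: d_def L_def)
        then have "real n * \<bar>- d n + c * h n\<bar> \<le> real n * (\<epsilon> * h n)"
          by (intro mult_left_mono) auto
        moreover have "real n * d n - c * (real n * h n) = - (real n * (- d n + c * h n))"
          by (simp add: algebra_simps)
        then have "\<bar>real n * d n - c * (real n * h n)\<bar> = real n * \<bar>- d n + c * h n\<bar>"
          by (simp only: abs_minus_cancel abs_mult abs_of_nat)
        ultimately have "dist (real n * d n - c * (real n * h n)) 0 \<le> real n * (\<epsilon> * h n)"
          by (simp only: dist_real_def diff_zero)
        also have "\<dots> = \<epsilon> * (real n * h n)" by simp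
        finally show ?case using elim by linarith
      qed
    qed
  qed
  have "d \<longlonglongrightarrow> 0"
    using nd by (rule tendsto_0_if_real_mult_tendsto)
  then have "(\<lambda>n. (real n * d n) * exp (- d n)) \<longlonglongrightarrow> c / \<theta> * exp (- 0)"
    by (intro tendsto_intros nd)
  then have low: "(\<lambda>n. (real n * d n) * exp (- d n)) \<longlonglongrightarrow> c / \<theta>" by simp
  have ratio: "L (Suc n) / L n = exp (- d n)" if "1 \<le> n" for n
    using that L_pos[of n] L_pos[of "Suc n"] by (simp add: d_def exp_diff)
  show ?thesis
  \<comment> \<open>Since the ratio is \<open>exp (- d n)\<close>, the squeeze is
    \<open>d * exp (- d) \<le> 1 - exp (- d) \<le> d\<close>, scaled by \<open>n\<close>.\<close>
  proof (rule tendsto_sandwich[OF _ _ low nd])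
    show "\<forall>\<^sub>F n in sequentially. real n * d n * exp (- d n) \<le> real n * (1 - L (Suc n) / L n)"
      using eventually_ge_at_top[of 1]
    proof eventually_elim
      case (elim n)
      have "(1 + d n) * exp (- d n) \<le> exp (d n) * exp (- d n)"
        by (intro mult_right_mono exp_ge_add_one_self) auto
      then have "d n * exp (- d n) \<le> 1 - exp (- d n)"
        by (simp add: algebra_simps flip: exp_add)
      then show ?case
        using elim by (simp add: ratio mult.assoc)
    qed
    show "\<forall>\<^sub>F n in sequentially. real n * (1 - L (Suc n) / L n) \<le> real n * d n"
      using eventually_ge_at_top[of 1]
    proof eventually_elim
      case (elim n)
      then show ?case
        using exp_ge_add_one_self[of "- d n"] by (auto simp: ratio intro!: mult_left_mono)
    qed
  qed
qed

section \<open>Comparison of \<open>loss\<close> with multiples of \<open>L\<close>\<close>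

lemma L_shift: "(\<lambda>n. L (n + k) / L n) \<longlonglongrightarrow> 1"
proof (induction k)
  case 0
  show ?case
    by (rule tendsto_eventually, rule eventually_mono[OF eventually_ge_at_top[of 1]])
      (use L_pos in force)
next
  case (Suc k)
  have "(\<lambda>n. 1 - (1 - L (Suc n) / L n)) \<longlonglongrightarrow> 1 - 0"
    by (intro tendsto_diff tendsto_const tendsto_0_if_real_mult_tendsto[OF L_step])
  then have one: "(\<lambda>n. L (Suc n) / L n) \<longlonglongrightarrow> 1" by simp
  have "(\<lambda>n. (L (Suc (n + k)) / L (n + k)) * (L (n + k) / L n)) \<longlonglongrightarrow> 1 * 1"
    by (intro tendsto_mult Suc LIMSEQ_ignore_initial_segment[OF one])
  then have *: "(\<lambda>n. (L (Suc (n + k)) / L (n + k)) * (L (n + k) / L n)) \<longlonglongrightarrow> 1" by simp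
  show ?case
  proof (rule Lim_transform_eventually[OF *])
    show "\<forall>\<^sub>F n in sequentially. (L (Suc (n + k)) / L (n + k)) * (L (n + k) / L n) = L (n + Suc k) / L n"
      using eventually_ge_at_top[of 1]
    proof eventually_elim
      case (elim n)
      then show ?case using L_pos[of "n + k"] by simp
    qed
  qed
qed

text \<open>As \<open>loss\<close> tends to \<open>0\<close>, it falls below
  \<open>\<rho> * L k\<close> at some time \<open>m\<close>. From then on \<open>step_mono\<close>
  and the supersolution inequality preserve the order, with time lag \<open>m - k\<close>. By
  \<open>L_shift\<close> the lag does not affect the ratio asymptotically, and the room between
  \<open>\<rho>\<close> and \<open>\<mu>\<close> absorbs the rest.\<close>

lemma loss_upper_comparison:
  assumes "0 < \<rho>" "\<rho> < \<mu>"
    and super: "\<forall>\<^sub>F n in sequentially. \<rho> * L n - \<rho> * L (Suc n) \<le> gain (\<rho> * L n)"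
  shows "\<forall>\<^sub>F n in sequentially. loss n / L n < \<mu>"
proof -
  obtain k where k: "1 \<le> k" "\<And>n. k \<le> n \<Longrightarrow> \<rho> * L n - \<rho> * L (Suc n) \<le> gain (\<rho> * L n)"
    using eventually_conj[OF super eventually_ge_at_top[of 1]]
    unfolding eventually_at_top_linorder by (metis linorder_linear)
  have "\<forall>\<^sub>F m in sequentially. loss m < \<rho> * L k \<and> k \<le> m"
    using order_tendstoD(2)[OF loss_tendsto_0, of "\<rho> * L k"] eventually_ge_at_top[of k] assms L_pos[OF k(1)]
    by (simp add: eventually_conj)
  then obtain m where m: "loss m < \<rho> * L k" "k \<le> m"
    using eventually_happens'[OF sequentially_bot] by blast
  have le: "loss (m + j) \<le> \<rho> * L (k + j)" for j
  proof (induction j)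
    case (Suc j)
    have "loss (m + Suc j) \<le> \<rho> * L (k + j) - gain (\<rho> * L (k + j))"
      using step_mono[OF less_imp_le[OF loss_pos] Suc] by simp
    then show ?case using k(2)[of "k + j"] by simp
  qed (use m in simp)
  define d where "d = m - k"
  have le': "loss (i + d) \<le> \<rho> * L i" if "k \<le> i" for i
    using le[of "i - k"] that m(2) by (simp add: d_def add.commute)
  have "(\<lambda>i. \<rho> * inverse (L (i + d) / L i)) \<longlonglongrightarrow> \<rho> * inverse 1"
    by (intro tendsto_intros L_shift) simp
  then have "\<forall>\<^sub>F i in sequentially. \<rho> * inverse (L (i + d) / L i) < \<mu>"
    using assms by (intro order_tendstoD(2)) auto
  then have "\<forall>\<^sub>F i in sequentially. loss (i + d) / L (i + d) < \<mu>"
    using eventually_ge_at_top[of k]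
  proof eventually_elim
    case (elim i)
    have "loss (i + d) / L (i + d) \<le> \<rho> * L i / L (i + d)"
      using le'[OF elim(2)] L_pos[of "i + d"] k(1) elim(2) by (intro divide_right_mono) auto
    then show ?case using elim by simp
  qed
  then show ?thesis
    using eventually_sequentially_seg[of "\<lambda>n. loss n / L n < \<mu>" d] by simp
qed

text \<open>Here the order can be started at time \<open>0\<close>, since
  \<open>\<rho> * L k < xF = loss 0\<close> for large \<open>k\<close>; now \<open>L\<close> is the
  sequence whose index runs ahead, by \<open>k\<close>.\<close>

lemma loss_lower_comparison:
  assumes "0 < \<rho>" "\<mu> < \<rho>"
    and sub: "\<forall>\<^sub>F n in sequentially. gain (\<rho> * L n) \<le> \<rho> * L n - \<rho> * L (Suc n)"
  shows "\<forall>\<^sub>F n in sequentially. \<mu> < loss n / L n"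
proof -
  have "(\<lambda>n. \<rho> * L n) \<longlonglongrightarrow> \<rho> * 0"
    by (intro tendsto_intros L_tendsto_0)
  then have "\<forall>\<^sub>F n in sequentially. \<rho> * L n < xF"
    using xF_pos by (intro order_tendstoD(2)) auto
  then have "\<forall>\<^sub>F n in sequentially. \<rho> * L n < xF \<and> 1 \<le> n \<and> gain (\<rho> * L n) \<le> \<rho> * L n - \<rho> * L (Suc n)"
    using eventually_ge_at_top[of 1] sub by eventually_elim simp
  then obtain k where k: "1 \<le> k" "\<rho> * L k < xF"
    "\<And>n. k \<le> n \<Longrightarrow> gain (\<rho> * L n) \<le> \<rho> * L n - \<rho> * L (Suc n)"
    unfolding eventually_at_top_linorder by (metis linorder_linear)
  have le: "\<rho> * L (k + j) \<le> loss j" for j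
  proof (induction j)
    case (Suc j)
    have "0 \<le> \<rho> * L (k + j)"
      using L_pos[of "k + j"] assms k(1) by simp
    then have "\<rho> * L (k + j) - gain (\<rho> * L (k + j)) \<le> loss (Suc j)"
      using step_mono[OF _ Suc] by simp
    then show ?case using k(3)[of "k + j"] by simp
  qed (use k in simp)
  have "(\<lambda>j. \<rho> * (L (j + k) / L j)) \<longlonglongrightarrow> \<rho> * 1"
    by (intro tendsto_intros L_shift)
  then have "\<forall>\<^sub>F j in sequentially. \<mu> < \<rho> * (L (j + k) / L j)"
    using assms by (intro order_tendstoD(1)) auto
  then show ?thesis
    using eventually_ge_at_top[of 1]
  proof eventually_elim
    case (elim j)
    have "\<rho> * L (j + k) / L j \<le> loss j / L j"
      using le[of j] L_pos[of j] elim(2) by (intro divide_right_mono) (auto simp: add.commute)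
    then show ?case using elim by simp
  qed
qed

section \<open>Leading coefficients and the limit of the loss ratio\<close>

lemma gain_limit:
  assumes "0 < c" "0 < \<rho>"
  shows "(\<lambda>n. real n * gain (\<rho> * L n) / L n) \<longlonglongrightarrow> \<rho> powr (\<theta> / c + 1) / (\<theta> / c + 1)"
proof -
  \<comment> \<open>After the rescaling \<open>y = z * L n\<close> the integrand tends to
    \<open>z powr (\<theta> / c)\<close>. As \<open>Q\<close> is monotone, its value at
    \<open>z = \<rho>\<close> bounds it, and that value converges; hence a constant majorant on
    \<open>{0..\<rho>}\<close>.\<close>
  define f where "f = (\<lambda>n z. indicator {0..\<rho>} z * (real n * Q (z * L n)))"
  have "(\<lambda>n. real n * Q (\<rho> * L n)) \<longlonglongrightarrow> \<rho> powr (\<theta> / c)"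
    using assms by (rule tail_limit)
  then have "\<forall>\<^sub>F n in sequentially. real n * Q (\<rho> * L n) < \<rho> powr (\<theta> / c) + 1"
    by (rule order_tendstoD(2)) simp
  then obtain N where N: "\<And>n. N \<le> n \<Longrightarrow> real n * Q (\<rho> * L n) < \<rho> powr (\<theta> / c) + 1"
    unfolding eventually_at_top_linorder by blast
  define N' where "N' = max N 1"
  have "(\<lambda>n. \<integral>z. f (n + N') z \<partial>lborel) \<longlonglongrightarrow> (\<integral>z. indicator {0..\<rho>} z * z powr (\<theta> / c) \<partial>lborel)"
  proof (rule integral_dominated_convergence)
    show "integrable lborel (\<lambda>z. indicator {0..\<rho>} z * (\<rho> powr (\<theta> / c) + 1))"
      by (rule integrable_indicator_times_bounded[OF _ order_refl]) simp
    show "AE z in lborel. (\<lambda>n. f (n + N') z) \<longlonglongrightarrow> indicator {0..\<rho>} z * z powr (\<theta> / c)"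
    proof (rule AE_mp[OF AE_lborel_singleton[of 0]], intro AE_I2 impI)
      fix z :: real assume "z \<noteq> 0"
      show "(\<lambda>n. f (n + N') z) \<longlonglongrightarrow> indicator {0..\<rho>} z * z powr (\<theta> / c)"
      proof (cases "z \<in> {0..\<rho>}")
        case True
        then have "(\<lambda>n. real n * Q (z * L n)) \<longlonglongrightarrow> z powr (\<theta> / c)"
          using assms(1) \<open>z \<noteq> 0\<close> by (intro tail_limit) auto
        from LIMSEQ_ignore_initial_segment[OF this, of N'] show ?thesis
          using True by (simp add: f_def)
      qed (simp add: f_def)
    qed
    show "AE z in lborel. norm (f (n + N') z) \<le> indicator {0..\<rho>} z * (\<rho> powr (\<theta> / c) + 1)" for n
    proof (rule AE_I2)
      fix z
      have "0 < L (n + N')" by (rule L_pos) (simp add: N'_def)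
      then have "real (n + N') * Q (z * L (n + N')) \<le> real (n + N') * Q (\<rho> * L (n + N'))" if "z \<le> \<rho>"
        using that by (intro mult_left_mono Q_mono mult_right_mono) auto
      then show "norm (f (n + N') z) \<le> indicator {0..\<rho>} z * (\<rho> powr (\<theta> / c) + 1)"
        using N[of "n + N'", unfolded N'_def, OF le_trans[OF max.cobounded1 le_add2], folded N'_def] Q_nonneg
        by (auto simp: f_def indicator_def)
    qed
  qed (auto simp: f_def)
  then have lim: "(\<lambda>n. \<integral>z. f n z \<partial>lborel) \<longlonglongrightarrow> (\<integral>z. indicator {0..\<rho>} z * z powr (\<theta> / c) \<partial>lborel)"
    by (rule LIMSEQ_offset)
  have "((\<lambda>z. z powr (\<theta> / c)) has_integral \<rho> powr (\<theta> / c + 1) / (\<theta> / c + 1)) {0..\<rho>}"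
    using assms divide_pos_pos[OF theta_pos assms(1)] by (intro has_integral_powr_from_0) linarith+
  moreover have "set_integrable lborel {0..\<rho>} (\<lambda>z. z powr (\<theta> / c))"
    using assms theta_pos by (intro borel_integrable_atLeastAtMost' continuous_on_powr' continuous_intros) auto
  ultimately have val: "(\<integral>z. indicator {0..\<rho>} z * z powr (\<theta> / c) \<partial>lborel) = \<rho> powr (\<theta> / c + 1) / (\<theta> / c + 1)"
    using set_borel_integral_eq_integral(2)[of "{0..\<rho>}" "\<lambda>z. z powr (\<theta> / c)"]
    by (simp add: set_lebesgue_integral_def integral_unique)
  show ?thesis
  proof (rule Lim_transform_eventually[OF lim[unfolded val]])
    show "\<forall>\<^sub>F n in sequentially. (\<integral>z. f n z \<partial>lborel) = real n * gain (\<rho> * L n) / L n"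
      using eventually_ge_at_top[of 1]
    proof eventually_elim
      case (elim n)
      have "(\<integral>z. f n z \<partial>lborel) = real n * (\<integral>z. indicator {0..\<rho>} z * Q (z * L n) \<partial>lborel)"
        by (simp add: f_def mult.left_commute)
      then show ?case
        using integral_indicator_interval_scale[OF L_pos[OF elim], of "\<rho> * L n" Q] L_pos[OF elim]
        by (simp add: gain_def)
    qed
  qed
qed

lemma step_limit: "(\<lambda>n. real n * (\<rho> * L n - \<rho> * L (Suc n)) / L n) \<longlonglongrightarrow> \<rho> * (c / \<theta>)"
proof (rule Lim_transform_eventually)
  show "(\<lambda>n. \<rho> * (real n * (1 - L (Suc n) / L n))) \<longlonglongrightarrow> \<rho> * (c / \<theta>)"
    by (intro tendsto_intros L_step)
  show "\<forall>\<^sub>F n in sequentially. \<rho> * (real n * (1 - L (Suc n) / L n)) = real n * (\<rho> * L n - \<rho> * L (Suc n)) / L n"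
    using eventually_ge_at_top[of 1]
  proof eventually_elim
    case (elim n)
    then show ?case using L_pos[of n] by (simp add: field_simps)
  qed
qed

lemma eventually_le_if_scaled_limits_less:
  assumes "(\<lambda>n. real n * f n / L n) \<longlonglongrightarrow> a" "(\<lambda>n. real n * g n / L n) \<longlonglongrightarrow> b" "a < b"
  shows "\<forall>\<^sub>F n in sequentially. f n \<le> g n"
  using tendsto_diff[OF assms(2,1), THEN order_tendstoD(1), of 0] eventually_ge_at_top[of 1] \<open>a < b\<close>
proof simp_all
  assume "\<forall>\<^sub>F n in sequentially. real n * f n / L n < real n * g n / L n"
  then show ?thesis
    using eventually_ge_at_top[of 1]
  proof eventually_elim
    case (elim n)
    then show ?case using L_pos[of n] by (simp add: divide_less_cancel)
  qed
qed

definition loss_const :: real where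
  "loss_const = ((\<theta> + c) / \<theta>) powr (c / \<theta>)"

lemma loss_const_pos: "0 < loss_const"
  using theta_pos c_nonneg by (simp add: loss_const_def)

lemma loss_const_slow: "c = 0 \<Longrightarrow> loss_const = 1"
  unfolding loss_const_def using theta_pos by simp

text \<open>Both sides of the defining inequality of a super- or subsolution \<open>\<rho> * L n\<close> are of order
  \<open>L n / n\<close>; their leading coefficients agree exactly at \<open>\<rho> = loss_const\<close>.\<close>

lemma coefficients_less_iff:
  assumes "0 < c" "0 < \<rho>"
  shows "\<rho> * (c / \<theta>) < \<rho> powr (\<theta> / c + 1) / (\<theta> / c + 1) \<longleftrightarrow> loss_const < \<rho>"
    and "\<rho> powr (\<theta> / c + 1) / (\<theta> / c + 1) < \<rho> * (c / \<theta>) \<longleftrightarrow> \<rho> < loss_const"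
proof -
  have r: "\<rho> powr (\<theta> / c + 1) = \<rho> * \<rho> powr (\<theta> / c)"
    using assms by (simp add: powr_add)
  have k: "loss_const powr (\<theta> / c) = (\<theta> + c) / \<theta>"
    using assms theta_pos by (simp add: loss_const_def powr_powr)
  have iff: "(\<theta> + c) / \<theta> < \<rho> powr (\<theta> / c) \<longleftrightarrow> loss_const < \<rho>"
    "\<rho> powr (\<theta> / c) < (\<theta> + c) / \<theta> \<longleftrightarrow> \<rho> < loss_const"
    using assms theta_pos loss_const_pos by (auto simp flip: k simp: powr_less_cancel_iff intro: powr_less_mono2)
      (metis divide_pos_pos linorder_not_less powr_mono2 less_imp_le)+
  \<comment> \<open>The common positive factor of both coefficients; cancelling it leaves
    \<open>(\<theta> + c) / \<theta>\<close> against
    \<open>\<rho> powr (\<theta> / c)\<close>.\<close>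
  define q where "q = \<rho> * c / (\<theta> + c)"
  have "0 < q" and "\<rho> * (c / \<theta>) = q * ((\<theta> + c) / \<theta>)"
    using assms theta_pos by (simp_all add: q_def)
  moreover have "\<rho> powr (\<theta> / c + 1) / (\<theta> / c + 1) = q * \<rho> powr (\<theta> / c)"
    unfolding r q_def using assms theta_pos by (simp add: field_simps)
  ultimately show "\<rho> * (c / \<theta>) < \<rho> powr (\<theta> / c + 1) / (\<theta> / c + 1) \<longleftrightarrow> loss_const < \<rho>"
    and "\<rho> powr (\<theta> / c + 1) / (\<theta> / c + 1) < \<rho> * (c / \<theta>) \<longleftrightarrow> \<rho> < loss_const"
    using iff by (simp_all only: mult_less_cancel_left_pos)
qed

lemma eventually_supersolution:
  assumes "loss_const < \<rho>"
  shows "\<forall>\<^sub>F n in sequentially. \<rho> * L n - \<rho> * L (Suc n) \<le> gain (\<rho> * L n)"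
proof (cases "c = 0")
  case False
  then have "0 < c" "0 < \<rho>" using c_nonneg assms loss_const_pos by auto
  then show ?thesis
    using assms coefficients_less_iff(1)
    by (intro eventually_le_if_scaled_limits_less[OF step_limit gain_limit]) auto
next
  case True
  \<comment> \<open>For \<open>c = 0\<close> the left side is of smaller order than
    \<open>L n / n\<close>. An intermediate level \<open>m > 1\<close> gives
    \<open>gain (\<rho> * L n) \<ge> (\<rho> - m) * L n * Q (m * L n)\<close>, and
    \<open>n * Q (m * L n) \<ge> 1\<close> eventually, so the gain is at least
    \<open>(\<rho> - m) * L n / n\<close>.\<close>
  define m where "m = (1 + \<rho>) / 2"
  have m: "1 < m" "m < \<rho>"
    using assms unfolding loss_const_slow[OF True] m_def by auto
  have "\<forall>\<^sub>F n in sequentially. 1 \<le> real n * Q (m * L n)"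
    using tail_slow(2)[OF True m(1)] by (rule filterlim_at_top[THEN iffD1, rule_format])
  moreover have "\<forall>\<^sub>F n in sequentially. real n * (\<rho> * L n - \<rho> * L (Suc n)) / L n < \<rho> - m"
    using step_limit[of \<rho>] True m by (intro order_tendstoD(2)) auto
  ultimately show ?thesis
    using eventually_ge_at_top[of 1]
  proof eventually_elim
    case (elim n)
    have Ln: "0 < L n" using elim L_pos by simp
    have "real n * (\<rho> * L n - \<rho> * L (Suc n)) < (\<rho> - m) * L n"
      using elim Ln by (simp add: divide_less_eq)
    also have "\<dots> \<le> (\<rho> - m) * L n * (real n * Q (m * L n))"
      using mult_left_mono[OF elim(1), of "(\<rho> - m) * L n"] m Ln by simp
    also have "\<dots> = real n * ((\<rho> * L n - m * L n) * Q (m * L n))"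
      by (simp add: algebra_simps)
    also have "\<dots> \<le> real n * gain (\<rho> * L n)"
      using m Ln by (intro mult_left_mono gain_ge) auto
    finally show ?case using elim by simp
  qed
qed

lemma loss_ratio_limit: "(\<lambda>n. loss n / L n) \<longlonglongrightarrow> loss_const"
proof (rule order_tendstoI)
  fix \<mu> assume "loss_const < \<mu>"
  then obtain \<rho> where "loss_const < \<rho>" "\<rho> < \<mu>" using dense by blast
  then show "\<forall>\<^sub>F n in sequentially. loss n / L n < \<mu>"
    using loss_const_pos by (intro loss_upper_comparison eventually_supersolution) auto
next
  fix \<mu> assume "\<mu> < loss_const"
  then have "max 0 \<mu> < loss_const" using loss_const_pos by simp
  then obtain \<rho> where \<rho>: "0 < \<rho>" "\<mu> < \<rho>" "\<rho> < loss_const" using dense by (metis max_less_iff_conj)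
  show "\<forall>\<^sub>F n in sequentially. \<mu> < loss n / L n"
  proof (cases "c = 0")
    case False
    then have "0 < c" using c_nonneg by simp
    then show ?thesis
      using \<rho> coefficients_less_iff(2)
      by (intro loss_lower_comparison[OF \<rho>(1,2)]
          eventually_le_if_scaled_limits_less[OF gain_limit step_limit]) auto
  next
    case True
    then have "\<rho> < 1" using \<rho>(3) unfolding loss_const_slow[OF True] by simp
    \<comment> \<open>For \<open>c = 0\<close> and \<open>\<rho> < 1\<close> both sides of the
      subsolution inequality are of smaller order than \<open>L n / n\<close>, so leading
      coefficients decide nothing. The bound \<open>loss_lower\<close> at level
      \<open>\<rho> * L n\<close> suffices, because \<open>n * Q (\<rho> * L n)\<close> tends to
      \<open>0\<close>.\<close>
    have "(\<lambda>n. \<rho> * (1 - Q (\<rho> * L n)) ^ n) \<longlonglongrightarrow> \<rho> * exp (- 0)"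
      using tail_slow(1)[OF True \<open>\<rho> < 1\<close>] by (intro tendsto_intros tendsto_exp_limit_sequence)
    then have "\<forall>\<^sub>F n in sequentially. \<mu> < \<rho> * (1 - Q (\<rho> * L n)) ^ n"
      using \<rho> by (intro order_tendstoD(1)) auto
    moreover have "(\<lambda>n. \<rho> * L n) \<longlonglongrightarrow> \<rho> * 0"
      by (intro tendsto_intros L_tendsto_0)
    then have "\<forall>\<^sub>F n in sequentially. \<rho> * L n < xF"
      using xF_pos by (intro order_tendstoD(2)) auto
    ultimately show ?thesis
      using eventually_ge_at_top[of 1]
    proof eventually_elim
      case (elim n)
      have Ln: "0 < L n" using elim L_pos by simp
      have "\<rho> * (1 - Q (\<rho> * L n)) ^ n \<le> loss n / L n"
        using loss_lower[of "\<rho> * L n" n] elim Ln \<rho> by (simp add: field_simps)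
      then show ?case using elim by simp
    qed
  qed
qed

section \<open>The loss of the prophet\<close>

definition prophet_loss :: "nat \<Rightarrow> real" where
  "prophet_loss n = (\<integral>y. indicator {0..xF} y * (1 - Q y) ^ n \<partial>lborel)"

text \<open>The majorant for dominated convergence, independent of \<open>n\<close>. Up to
  \<open>r\<close> the power is bounded by \<open>1\<close>; beyond, it is at most
  \<open>exp (- ((z / r) powr \<kappa>))\<close> by \<open>tail_uniform_lower\<close>, which is
  below a multiple of \<open>1 / z\<^sup>2\<close>.\<close>

lemma no_exceedance_dominated:
  obtains r K N where "1 \<le> r" "0 \<le> K"
    "\<And>n z. N \<le> n \<Longrightarrow> 0 \<le> z \<Longrightarrow> z \<le> xF / L n \<Longrightarrow>
      (1 - Q (z * L n)) ^ n \<le> indicator {0..r} z + K * inverse (1 + z\<^sup>2)"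
proof -
  obtain r \<kappa> N where r: "1 \<le> r" "0 < \<kappa>"
    "\<And>n z. N \<le> n \<Longrightarrow> r \<le> z \<Longrightarrow> z \<le> xF / L n \<Longrightarrow> (z / r) powr \<kappa> \<le> real n * Q (z * L n)"
    using tail_uniform_lower by blast
  \<comment> \<open>The order \<open>m\<close> in \<open>exp_minus_le_fact_div_power\<close> is
    taken so large that the resulting exponent \<open>\<kappa> * m\<close> is at least
    \<open>2\<close>.\<close>
  define m where "m = nat \<lceil>2 / \<kappa>\<rceil>"
  have "2 / \<kappa> \<le> real m" unfolding m_def by linarith
  then have m: "2 \<le> \<kappa> * real m" using r(2) by (simp add: field_simps)
  \<comment> \<open>\<open>r\<^sup>2\<close> undoes the scaling by \<open>r\<close>; the
    \<open>2\<close> pays for replacing \<open>2 * z\<^sup>2\<close> by the smaller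
    \<open>1 + z\<^sup>2\<close>, where \<open>z > r \<ge> 1\<close>.\<close>
  define K where "K = 2 * fact m * r\<^sup>2"
  have K: "0 \<le> K" by (simp add: K_def)
  show thesis
  proof (rule that[OF r(1) K])
    fix n z assume n: "N \<le> n" and z: "0 \<le> z" "z \<le> xF / L n"
    show "(1 - Q (z * L n)) ^ n \<le> indicator {0..r} z + K * inverse (1 + z\<^sup>2)"
    proof (cases "z \<le> r")
      case True
      have "(1 - Q (z * L n)) ^ n \<le> 1"
        using Q_nonneg Q_le_1 by (intro power_le_one) auto
      moreover have "0 \<le> K * inverse (1 + z\<^sup>2)" using K by simp
      ultimately show ?thesis using True z by simp
    next
      case False
      then have zr: "1 < z / r" "r \<le> z" using r(1) by auto
      have "(1 - Q (z * L n)) ^ n \<le> exp (- (real n * Q (z * L n)))"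
        by (rule one_minus_power_le_exp[OF Q_nonneg Q_le_1])
      also have "\<dots> \<le> exp (- ((z / r) powr \<kappa>))"
        using r(3)[OF n zr(2) z(2)] by simp
      also have "\<dots> \<le> fact m / ((z / r) powr \<kappa>) ^ m"
        using zr by (intro exp_minus_le_fact_div_power) auto
      also have "((z / r) powr \<kappa>) ^ m = (z / r) powr (\<kappa> * real m)"
        using zr r(1) powr_realpow[of "(z / r) powr \<kappa>" m] by (auto simp: powr_powr)
      also have "fact m / (z / r) powr (\<kappa> * real m) \<le> fact m / (z / r) powr 2"
        using zr r(1) m by (intro divide_left_mono powr_mono mult_pos_pos) auto
      also have "\<dots> = K * inverse (2 * z\<^sup>2)"
        using zr r(1) by (simp add: K_def power_divide field_simps)
      also have "\<dots> \<le> K * inverse (1 + z\<^sup>2)"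
      proof (intro mult_left_mono K le_imp_inverse_le)
        show "1 + z\<^sup>2 \<le> 2 * z\<^sup>2" using zr r(1) one_le_power[of z 2] by simp
      qed (simp add: add_pos_nonneg)
      finally show ?thesis using False by simp
    qed
  qed
qed

lemma prophet_loss_ratio_limit: "(\<lambda>n. prophet_loss n / L n) \<longlonglongrightarrow> Gamma (1 + c / \<theta>)"
proof -
  define f where "f = (\<lambda>n z. indicator {0..xF / L n} z * (1 - Q (z * L n)) ^ n)"
  \<comment> \<open>For \<open>c = 0\<close> the integral is \<open>1 = Gamma 1\<close>. The
    exponent \<open>1 / (c / \<theta>)\<close> has the shape required by
    \<open>has_bochner_integral_exp_neg_powr\<close>.\<close>
  define g where "g = (\<lambda>z::real. if c = 0 then indicator {0..1} z
    else indicator {0<..} z * exp (- (z powr (1 / (c / \<theta>)))))"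
  have g_int: "(\<integral>z. g z \<partial>lborel) = Gamma (1 + c / \<theta>)"
  proof (cases "c = 0")
    case False
    then have "0 < c / \<theta>" using c_nonneg theta_pos by simp
    from has_bochner_integral_integral_eq[OF has_bochner_integral_exp_neg_powr[OF this]]
    show ?thesis using False by (simp add: g_def)
  qed (simp add: g_def)
  obtain r K N where rK: "1 \<le> r" "0 \<le> K"
    "\<And>n z. N \<le> n \<Longrightarrow> 0 \<le> z \<Longrightarrow> z \<le> xF / L n \<Longrightarrow>
      (1 - Q (z * L n)) ^ n \<le> indicator {0..r} z + K * inverse (1 + z\<^sup>2)"
    using no_exceedance_dominated by blast
  have "(\<lambda>n. \<integral>z. f (n + N) z \<partial>lborel) \<longlonglongrightarrow> (\<integral>z. g z \<partial>lborel)"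
  proof (rule integral_dominated_convergence)
    show "g \<in> borel_measurable lborel"
      unfolding g_def by (cases "c = 0") auto
    show "f (n + N) \<in> borel_measurable lborel" for n
      unfolding f_def by measurable
    have "integrable lborel (\<lambda>z::real. inverse (1 + z\<^sup>2))"
      using integrable_inverse_1_plus_square by (simp add: set_integrable_def einterval_def)
    then show "integrable lborel (\<lambda>z. indicator {0..r} z + K * inverse (1 + z\<^sup>2))"
      using rK(1)
      by (intro Bochner_Integration.integrable_add integrable_real_indicator integrable_mult_right)
        (auto simp: emeasure_lborel_Icc_eq)
    show "AE z in lborel. norm (f (n + N) z) \<le> indicator {0..r} z + K * inverse (1 + z\<^sup>2)" for n
    proof (rule AE_I2)
      fix z :: real
      have "0 \<le> (1 - Q (z * L (n + N))) ^ (n + N)" using Q_le_1 by simp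
      moreover have "0 \<le> indicator {0..r} z + K * inverse (1 + z\<^sup>2)"
        using rK by (intro add_nonneg_nonneg mult_nonneg_nonneg) auto
      ultimately show "norm (f (n + N) z) \<le> indicator {0..r} z + K * inverse (1 + z\<^sup>2)"
        using rK(3)[of "n + N" z] by (auto simp: f_def abs_mult indicator_def)
    qed
    \<comment> \<open>Two points are left out. At \<open>0\<close> the convergence fails for
      \<open>c > 0\<close>, since there \<open>f\<close> is eventually \<open>1\<close> and
      \<open>g\<close> is \<open>0\<close>. At \<open>1\<close> it fails for \<open>c = 0\<close>:
      there \<open>n * Q (L n) = 1\<close>, so the limit is \<open>exp (- 1)\<close>.\<close>
    show "AE z in lborel. (\<lambda>n. f (n + N) z) \<longlonglongrightarrow> g z"
    proof (rule AE_mp[OF AE_lborel_singleton[of 0] AE_mp[OF AE_lborel_singleton[of 1]]],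
        intro AE_I2 impI)
      fix z :: real assume z: "z \<noteq> 0" "z \<noteq> 1"
      show "(\<lambda>n. f (n + N) z) \<longlonglongrightarrow> g z"
      proof (cases "z < 0")
        case True
        then show ?thesis by (auto simp: f_def g_def)
      next
        case False
        then have "0 < z" using z by simp
        have power_lim: "(\<lambda>n. (1 - Q (z * L n)) ^ n) \<longlonglongrightarrow> g z"
        proof (cases "c = 0")
          case False
          then have "0 < c" using c_nonneg by simp
          have "(\<lambda>n. (1 - Q (z * L n)) ^ n) \<longlonglongrightarrow> exp (- (z powr (\<theta> / c)))"
            by (rule tendsto_exp_limit_sequence[OF tail_limit[OF \<open>0 < c\<close> \<open>0 < z\<close>]])
          then show ?thesis using False \<open>0 < z\<close> by (simp add: g_def)
        next
          case True
          show ?thesis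
          proof (cases "z < 1")
            case less: True
            then show ?thesis
              using tendsto_exp_limit_sequence[OF tail_slow(1)[OF True less]] True \<open>0 < z\<close>
              by (simp add: g_def)
          next
            case False
            then have "1 < z" using z by simp
            have "(\<lambda>n. exp (- (real n * Q (z * L n)))) \<longlonglongrightarrow> 0"
              by (rule filterlim_compose[OF exp_at_bot])
                (use tail_slow(2)[OF True \<open>1 < z\<close>] in \<open>simp add: filterlim_uminus_at_bot\<close>)
            then have "(\<lambda>n. (1 - Q (z * L n)) ^ n) \<longlonglongrightarrow> 0"
              by (rule tendsto_sandwich[OF _ _ tendsto_const, rotated -1])
                (auto intro!: always_eventually one_minus_power_le_exp zero_le_power simp: Q_nonneg Q_le_1)
            then show ?thesis using True \<open>1 < z\<close> by (simp add: g_def)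
          qed
        qed
        \<comment> \<open>For fixed \<open>z\<close> the truncation at \<open>xF / L n\<close> is
          eventually inactive, so \<open>f n z\<close> is the bare power.\<close>
        have "(\<lambda>n. z * L n) \<longlonglongrightarrow> z * 0" by (intro tendsto_intros L_tendsto_0)
        then have "\<forall>\<^sub>F n in sequentially. z * L n < xF"
          using xF_pos by (intro order_tendstoD(2)) auto
        then have "\<forall>\<^sub>F n in sequentially. (1 - Q (z * L n)) ^ n = f n z"
          using eventually_ge_at_top[of 1]
        proof eventually_elim
          case (elim n)
          then show ?case using L_pos[of n] \<open>0 < z\<close> by (simp add: f_def field_simps)
        qed
        then have "(\<lambda>n. f n z) \<longlonglongrightarrow> g z"
          by (rule Lim_transform_eventually[OF power_lim])
        then show ?thesis by (rule LIMSEQ_ignore_initial_segment)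
      qed
    qed
  qed
  then have lim: "(\<lambda>n. \<integral>z. f n z \<partial>lborel) \<longlonglongrightarrow> Gamma (1 + c / \<theta>)"
    unfolding g_int by (rule LIMSEQ_offset)
  show ?thesis
  proof (rule Lim_transform_eventually[OF lim])
    show "\<forall>\<^sub>F n in sequentially. (\<integral>z. f n z \<partial>lborel) = prophet_loss n / L n"
      using eventually_ge_at_top[of 1]
    proof eventually_elim
      case (elim n)
      then show ?case
        using integral_indicator_interval_scale[OF L_pos[OF elim], of xF "\<lambda>y. (1 - Q y) ^ n"] L_pos[OF elim]
        by (simp add: prophet_loss_def f_def)
    qed
  qed
qed

end

section \<open>Dynamic programming\<close>

text \<open>Layer-cake formula: \<open>b - Z\<close> is the length of the set of \<open>x\<close> in
  \<open>{a..b}\<close> with \<open>Z \<le> x\<close>; Fubini exchanges this length with the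
  expectation.\<close>

lemma (in prob_space) expectation_eq_integral_cdf:
  assumes Z [measurable]: "random_variable borel Z"
    and bounds: "AE \<omega> in M. a \<le> Z \<omega> \<and> Z \<omega> \<le> b"
  shows "expectation Z = b - (\<integral>x. indicator {a..b} x * prob {\<omega> \<in> space M. Z \<omega> \<le> x} \<partial>lborel)"
proof -
  interpret pair_sigma_finite M lborel ..
  define f where "f = (\<lambda>\<omega> x. indicator {a..b} x * (if Z \<omega> \<le> x then 1 else 0 :: real))"
  have f_measurable [measurable]: "case_prod f \<in> borel_measurable (M \<Otimes>\<^sub>M lborel)"
    unfolding f_def by measurable
  have inner: "(\<integral>x. f \<omega> x \<partial>lborel) = b - Z \<omega>" if "a \<le> Z \<omega>" "Z \<omega> \<le> b" for \<omega>
  proof -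
    have "f \<omega> = indicator {Z \<omega>..b}"
      using that by (auto simp: f_def indicator_def fun_eq_iff)
    then show ?thesis using that by simp
  qed
  have int_Z: "integrable M Z"
    using bounds by (intro integrable_const_bound[where B = "max \<bar>a\<bar> \<bar>b\<bar>"]) auto
  have section_integrable: "integrable lborel (f \<omega>)" for \<omega>
  proof (rule Bochner_Integration.integrable_bound)
    show "integrable lborel (indicator {a..b} :: real \<Rightarrow> real)"
      by (cases "a \<le> b") auto
  qed (auto simp: f_def indicator_def)
  have "integrable (M \<Otimes>\<^sub>M lborel) (case_prod f)"
  proof (rule Fubini_integrable)
    have "AE \<omega> in M. b - Z \<omega> = (\<integral>x. norm (case_prod f (\<omega>, x)) \<partial>lborel)"
      using bounds
    proof eventually_elim
      case (elim \<omega>)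
      have "(\<lambda>x. norm (case_prod f (\<omega>, x))) = f \<omega>"
        by (auto simp: f_def fun_eq_iff abs_mult)
      then show ?case using inner elim by simp
    qed
    then show "integrable M (\<lambda>\<omega>. \<integral>x. norm (case_prod f (\<omega>, x)) \<partial>lborel)"
      using int_Z by (subst integrable_cong_AE[symmetric, where f = "\<lambda>\<omega>. b - Z \<omega>"]) auto
  qed (auto simp: section_integrable)
  then have "(\<integral>x. (\<integral>\<omega>. f \<omega> x \<partial>M) \<partial>lborel) = (\<integral>\<omega>. (\<integral>x. f \<omega> x \<partial>lborel) \<partial>M)"
    by (rule Fubini_integral)
  also have "\<dots> = (\<integral>\<omega>. b - Z \<omega> \<partial>M)"
    using bounds inner by (intro integral_cong_AE) auto
  also have "\<dots> = b - expectation Z"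
    using int_Z by (simp add: prob_space)
  also have "(\<lambda>x. \<integral>\<omega>. f \<omega> x \<partial>M) = (\<lambda>x. indicator {a..b} x * prob {\<omega> \<in> space M. Z \<omega> \<le> x})"
  proof
    fix x
    have "(\<integral>\<omega>. (if Z \<omega> \<le> x then 1 else 0) \<partial>M) = (\<integral>\<omega>. indicator {\<omega> \<in> space M. Z \<omega> \<le> x} \<omega> \<partial>M)"
      by (intro Bochner_Integration.integral_cong) (auto simp: indicator_def)
    also have "\<dots> = prob {\<omega> \<in> space M. Z \<omega> \<le> x}"
    proof -
      have "{\<omega> \<in> space M. Z \<omega> \<le> x} \<in> events" by measurable
      then show ?thesis by simp
    qed
    finally show "(\<integral>\<omega>. f \<omega> x \<partial>M) = indicator {a..b} x * prob {\<omega> \<in> space M. Z \<omega> \<le> x}"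
      by (simp add: f_def)
  qed
  finally show ?thesis by simp
qed

text \<open>\<open>w k\<close> is the gap between the endpoint and the optimal value with \<open>k\<close> observations left.\<close>

locale bounded_iid_sample = prob_space M for M :: "'a measure" +
  fixes X :: "nat \<Rightarrow> 'a \<Rightarrow> real" and n :: nat and F :: "real \<Rightarrow> real" and xF :: real and w :: "nat \<Rightarrow> real"
  assumes indep: "indep_vars (\<lambda>_. borel) X {1..n}"
    and prob_le: "t \<in> {1..n} \<Longrightarrow> prob {\<omega> \<in> space M. X t \<omega> \<le> x} = F x"
    and F_neg: "x < 0 \<Longrightarrow> F x = 0"
    and F_xF: "F xF = 1"
    and w_0: "w 0 = xF"
    and w_Suc: "w (Suc k) = (\<integral>x. indicator {xF - w k..xF} x * F x \<partial>lborel)"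
    and w_nonneg: "0 \<le> w k"
    and w_le: "w k \<le> xF"
begin

lemma X_measurable [measurable]: "t \<in> {1..n} \<Longrightarrow> random_variable borel (X t)"
  using indep by (auto simp: indep_vars_def)

lemma AE_X_bounds:
  assumes t: "t \<in> {1..n}"
  shows "AE \<omega> in M. 0 \<le> X t \<omega> \<and> X t \<omega> \<le> xF"
proof -
  have [measurable]: "random_variable borel (X t)" using t by (rule X_measurable)
  have "AE \<omega> in M. \<omega> \<in> {\<omega> \<in> space M. X t \<omega> \<le> xF}"
    using prob_le[OF t, of xF] F_xF by (intro AE_prob_1) simp
  then have "AE \<omega> in M. X t \<omega> \<le> xF"
    by eventually_elim simp
  \<comment> \<open>\<open>F\<close> is known to vanish only at strictly negative points, so the
    event of a negative value is exhausted by countably many null sets.\<close>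
  moreover have "AE \<omega> in M. \<forall>k::nat. - (1 / real (Suc k)) < X t \<omega>"
  proof (rule AE_all_countable[THEN iffD2], intro allI)
    fix k :: nat
    have "prob {\<omega> \<in> space M. X t \<omega> \<le> - (1 / real (Suc k))} = 0"
      using prob_le[OF t] F_neg by simp
    then have "AE \<omega> in M. \<not> X t \<omega> \<le> - (1 / real (Suc k))"
      by (subst (asm) prob_eq_0) auto
    then show "AE \<omega> in M. - (1 / real (Suc k)) < X t \<omega>" by (simp add: not_le)
  qed
  ultimately show ?thesis
  proof eventually_elim
    case (elim \<omega>)
    have "0 \<le> X t \<omega>"
    proof (rule ccontr)
      assume "\<not> 0 \<le> X t \<omega>"
      then obtain k where "1 / real (Suc k) < - X t \<omega>"
        using reals_Archimedean[of "- X t \<omega>"] by (auto simp: inverse_eq_divide)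
      then show False using elim(2)[rule_format, of k] by simp
    qed
    then show ?case using elim by simp
  qed
qed

text \<open>One Bellman step: the value of choosing between the current observation and the
  continuation value \<open>xF - w k\<close>. From that value upwards the maximum has the same
  distribution function as \<open>X t\<close>.\<close>

lemma expectation_max:
  assumes t: "t \<in> {1..n}"
  shows "expectation (\<lambda>\<omega>. max (X t \<omega>) (xF - w k)) = xF - w (Suc k)"
proof -
  have [measurable]: "random_variable borel (X t)" using t by (rule X_measurable)
  have "expectation (\<lambda>\<omega>. max (X t \<omega>) (xF - w k)) =
      xF - (\<integral>x. indicator {xF - w k..xF} x * prob {\<omega> \<in> space M. max (X t \<omega>) (xF - w k) \<le> x} \<partial>lborel)"
    using AE_X_bounds[OF t] w_nonneg[of k] by (intro expectation_eq_integral_cdf) auto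
  also have "(\<lambda>x. indicator {xF - w k..xF} x * prob {\<omega> \<in> space M. max (X t \<omega>) (xF - w k) \<le> x}) =
      (\<lambda>x. indicator {xF - w k..xF} x * F x)"
    using prob_le[OF t] by (auto simp: fun_eq_iff indicator_def)
  finally show ?thesis by (simp add: w_Suc)
qed

lemma OPT_eq:
  assumes "1 \<le> n"
  shows "OPT M X n = xF - (\<integral>x. indicator {0..xF} x * F x ^ n \<partial>lborel)"
proof -
  have ne: "{1..n} \<noteq> {}" and one: "1 \<in> {1..n}" using assms by simp_all
  have Max_le: "Max ((\<lambda>t. X t \<omega>) ` {1..n}) \<le> x \<longleftrightarrow> (\<forall>t\<in>{1..n}. X t \<omega> \<le> x)" for \<omega> x
    using ne by (subst Max_le_iff) blast+
  have "AE \<omega> in M. \<forall>t\<in>{1..n}. 0 \<le> X t \<omega> \<and> X t \<omega> \<le> xF"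
    by (rule AE_finite_allI) (rule finite_atLeastAtMost, rule AE_X_bounds)
  then have bounds: "AE \<omega> in M. 0 \<le> Max ((\<lambda>t. X t \<omega>) ` {1..n}) \<and> Max ((\<lambda>t. X t \<omega>) ` {1..n}) \<le> xF"
  proof eventually_elim
    case (elim \<omega>)
    have "X 1 \<omega> \<le> Max ((\<lambda>t. X t \<omega>) ` {1..n})"
      using one by (intro Max_ge finite_imageI finite_atLeastAtMost imageI)
    moreover have "0 \<le> X 1 \<omega>" using elim one by blast
    ultimately show ?case using elim unfolding Max_le by (blast intro: order_trans)
  qed
  have "prob {\<omega> \<in> space M. Max ((\<lambda>t. X t \<omega>) ` {1..n}) \<le> x} = F x ^ n" for x
  proof -
    have "{\<omega> \<in> space M. Max ((\<lambda>t. X t \<omega>) ` {1..n}) \<le> x} = (\<Inter>t\<in>{1..n}. X t -` {..x} \<inter> space M)"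
      unfolding Max_le using one by blast
    also have "prob \<dots> = (\<Prod>t\<in>{1..n}. prob (X t -` {..x} \<inter> space M))"
      by (rule indep_varsD_finite[OF indep ne]) simp_all
    also have "\<dots> = (\<Prod>t\<in>{1..n}. F x)"
    proof (rule prod.cong[OF refl])
      fix t assume "t \<in> {1..n}"
      moreover have "X t -` {..x} \<inter> space M = {\<omega> \<in> space M. X t \<omega> \<le> x}" by auto
      ultimately show "prob (X t -` {..x} \<inter> space M) = F x" using prob_le by simp
    qed
    finally show ?thesis by simp
  qed
  moreover have "random_variable borel (\<lambda>\<omega>. Max ((\<lambda>t. X t \<omega>) ` {1..n}))"
    by (intro borel_measurable_Max finite_atLeastAtMost X_measurable)
  ultimately show ?thesis
    unfolding OPT_def using expectation_eq_integral_cdf[OF _ bounds] by simp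
qed

section \<open>Past and present of the observations\<close>

lemma space_obs_filtration [simp]: "space (obs_filtration M X n t) = space M"
  unfolding obs_filtration_def by (rule space_measure_of) auto

lemma sets_obs_filtration: "sets (obs_filtration M X n t) =
    sigma_sets (space M) (\<Union>i\<in>{1..min t n}. {X i -` B \<inter> space M | B. B \<in> sets borel})"
  unfolding obs_filtration_def by (rule sets_measure_of) auto

lemma sets_obs_filtration_subset: "sets (obs_filtration M X n t) \<subseteq> events"
  unfolding sets_obs_filtration
  by (rule sets.sigma_sets_subset) (auto intro!: measurable_sets[OF X_measurable])

text \<open>The sigma-algebras generated by the disjoint index blocks \<open>{1..t - 1}\<close> and
  \<open>{t}\<close> are independent; \<open>A\<close> lies in the first and \<open>f (X t)\<close>
  is measurable for the second.\<close>

lemma expectation_past_times_present: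
  assumes t: "t \<in> {1..n}" and A: "A \<in> sets (obs_filtration M X n (t - 1))"
    and f [measurable]: "f \<in> borel_measurable borel" and int: "integrable M (\<lambda>\<omega>. f (X t \<omega>))"
  shows "expectation (\<lambda>\<omega>. indicator A \<omega> * f (X t \<omega>)) = prob A * expectation (\<lambda>\<omega>. f (X t \<omega>))"
proof -
  have [measurable]: "random_variable borel (X t)" using t by (rule X_measurable)
  have A_event [measurable]: "A \<in> events" using A sets_obs_filtration_subset by blast
  define E where "E = (\<lambda>i. {X i -` B \<inter> space M | B. B \<in> sets (borel :: real measure)})"
  \<comment> \<open>The blocks are indexed by \<open>bool\<close>, the form in which
    \<open>indep_set_def\<close> states independence of two families.\<close>
  define I where "I = case_bool {1..t - 1} {t}"
  have "indep_sets E {1..n}"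
    using indep by (simp add: indep_vars_def2 E_def)
  then have "indep_sets E (\<Union>b\<in>UNIV. I b)"
    by (rule indep_sets_mono_index[rotated]) (use t in \<open>auto simp: I_def split: bool.splits\<close>)
  moreover have "Int_stable (E i)" for i
    unfolding Int_stable_def
  proof safe
    fix a b assume "a \<in> E i" "b \<in> E i"
    then obtain B C where "a = X i -` B \<inter> space M" "b = X i -` C \<inter> space M"
      "B \<in> sets borel" "C \<in> sets borel" by (auto simp: E_def)
    then have "a \<inter> b = X i -` (B \<inter> C) \<inter> space M" "B \<inter> C \<in> sets borel" by auto
    then show "a \<inter> b \<in> E i" unfolding E_def by blast
  qed
  moreover have "disjoint_family_on I UNIV"
    using t by (auto simp: disjoint_family_on_def I_def split: bool.splits)
  ultimately have sig: "indep_sets (\<lambda>b. sigma_sets (space M) (\<Union>i\<in>I b. E i)) UNIV"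
    by (rule indep_sets_collect_sigma)
  have past: "sets (obs_filtration M X n (t - 1)) = sigma_sets (space M) (\<Union>i\<in>I True. E i)"
  proof -
    have "min (t - 1) n = t - 1" using t by auto
    then show ?thesis unfolding sets_obs_filtration I_def E_def by simp
  qed
  have ind_meas: "indicator A \<in> borel_measurable (obs_filtration M X n (t - 1))"
    using A by simp
  have "indep_var borel (indicator A :: 'a \<Rightarrow> real) borel (\<lambda>\<omega>. f (X t \<omega>))"
    unfolding indep_var_eq indep_set_def
  proof (intro conjI indep_sets_mono_sets[OF sig])
    fix b :: bool
    show "(case b of
        True \<Rightarrow> sigma_sets (space M) {(indicator A :: 'a \<Rightarrow> real) -` B \<inter> space M | B. B \<in> sets borel}
      | False \<Rightarrow> sigma_sets (space M) {(\<lambda>\<omega>. f (X t \<omega>)) -` B \<inter> space M | B. B \<in> sets borel})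
      \<subseteq> sigma_sets (space M) (\<Union>i\<in>I b. E i)"
    proof (cases b)
      case True
      have "sigma_sets (space M) {(indicator A :: 'a \<Rightarrow> real) -` B \<inter> space M | B. B \<in> sets borel}
          \<subseteq> sets (obs_filtration M X n (t - 1))"
        using measurable_sets[OF ind_meas]
        by (intro sets.sigma_sets_subset[of _ "obs_filtration M X n (t - 1)", unfolded space_obs_filtration]) auto
      then show ?thesis using True past by simp
    next
      case False
      have "{(\<lambda>\<omega>. f (X t \<omega>)) -` B \<inter> space M | B. B \<in> sets borel} \<subseteq> E t"
      proof
        fix a assume "a \<in> {(\<lambda>\<omega>. f (X t \<omega>)) -` B \<inter> space M | B. B \<in> sets borel}"
        then obtain B where "a = (\<lambda>\<omega>. f (X t \<omega>)) -` B \<inter> space M" "B \<in> sets borel" by auto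
        moreover from this have "f -` B \<in> sets borel"
          using measurable_sets[OF f, of B] by simp
        ultimately show "a \<in> E t"
          unfolding E_def by (auto intro!: exI[of _ "f -` B"])
      qed
      then show ?thesis using False by (simp add: I_def sigma_sets_mono')
    qed
  qed measurable
  moreover have ind_int: "integrable M (indicator A :: 'a \<Rightarrow> real)"
    by (intro integrable_real_indicator A_event) (simp add: emeasure_eq_measure)
  ultimately have "expectation (\<lambda>\<omega>. indicator A \<omega> * f (X t \<omega>))
      = expectation (indicator A) * expectation (\<lambda>\<omega>. f (X t \<omega>))"
    using int by (intro indep_var_lebesgue_integral)
  then show ?thesis by simp
qed

text \<open>Reaching time \<open>t\<close> means not having stopped by \<open>t - 1\<close>, so it
  is decided by the first \<open>t - 1\<close> observations. This offset is what makes the event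
  independent of \<open>X t\<close>.\<close>

lemma policy_events:
  assumes "\<sigma> \<in> policies M X n"
  shows "{\<omega> \<in> space M. \<sigma> \<omega> = t} \<in> events"
    and "1 \<le> t \<Longrightarrow> {\<omega> \<in> space M. t \<le> \<sigma> \<omega>} \<in> sets (obs_filtration M X n (t - 1))"
proof -
  have st: "stopping_time (obs_filtration M X n) \<sigma>"
    using assms by (simp add: policies_def)
  have le: "{\<omega> \<in> space M. \<sigma> \<omega> \<le> s} \<in> sets (obs_filtration M X n s)" for s
    using stopping_timeD[OF st, of s] by (simp add: pred_def)
  have gt: "{\<omega> \<in> space M. s < \<sigma> \<omega>} \<in> sets (obs_filtration M X n s)" for s
    using stopping_timeD2[OF st, of s] by (simp add: pred_def)
  show "{\<omega> \<in> space M. t \<le> \<sigma> \<omega>} \<in> sets (obs_filtration M X n (t - 1))" if "1 \<le> t"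
  proof -
    have "{\<omega> \<in> space M. t \<le> \<sigma> \<omega>} = {\<omega> \<in> space M. t - 1 < \<sigma> \<omega>}" using that by auto
    then show ?thesis using gt by simp
  qed
  have le_event: "{\<omega> \<in> space M. \<sigma> \<omega> \<le> s} \<in> events" for s
    using le sets_obs_filtration_subset by blast
  show "{\<omega> \<in> space M. \<sigma> \<omega> = t} \<in> events"
  \<comment> \<open>At \<open>t = 0\<close> truncated subtraction gives \<open>t - 1 = 0\<close>,
    and the difference of events used otherwise would be empty.\<close>
  proof (cases "t = 0")
    case True
    then have "{\<omega> \<in> space M. \<sigma> \<omega> = t} = {\<omega> \<in> space M. \<sigma> \<omega> \<le> 0}" by auto
    then show ?thesis by (simp only: le_event)
  next
    case False
    then have "{\<omega> \<in> space M. \<sigma> \<omega> = t} = {\<omega> \<in> space M. \<sigma> \<omega> \<le> t} - {\<omega> \<in> space M. \<sigma> \<omega> \<le> t - 1}" by auto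
    then show ?thesis by (simp only: sets.Diff[OF le_event le_event])
  qed
qed

section \<open>Backward induction over policies\<close>

lemma integrable_X: "t \<in> {1..n} \<Longrightarrow> integrable M (X t)"
  using AE_X_bounds[of t] by (intro integrable_const_bound[where B = xF]) auto

text \<open>The reward from stopping at time \<open>s\<close> or later. As a sum over times up to
  \<open>n\<close> it lets one time be split off, and the stopping value \<open>n + 1\<close>
  contributes \<open>0\<close> by itself.\<close>

definition partial_reward :: "('a \<Rightarrow> nat) \<Rightarrow> nat \<Rightarrow> real" where
  "partial_reward \<sigma> s = expectation (\<lambda>\<omega>. \<Sum>t\<in>{s..n}. indicator {\<omega> \<in> space M. \<sigma> \<omega> = t} \<omega> * X t \<omega>)"

lemma expected_reward_eq_partial_reward:
  assumes "\<sigma> \<in> policies M X n"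
  shows "expected_reward M X n \<sigma> = partial_reward \<sigma> 1"
  unfolding expected_reward_def partial_reward_def
proof (rule Bochner_Integration.integral_cong[OF refl])
  fix \<omega> assume \<omega>: "\<omega> \<in> space M"
  then have "\<sigma> \<omega> \<in> {1..n} \<union> {n + 1}" using assms by (auto simp: policies_def)
  moreover have "(\<Sum>t\<in>{1..n}. indicator {\<omega> \<in> space M. \<sigma> \<omega> = t} \<omega> * X t \<omega>)
      = (\<Sum>t\<in>{1..n}. if t = \<sigma> \<omega> then X t \<omega> else 0)"
    using \<omega> by (intro sum.cong) (auto simp: indicator_def)
  ultimately show "(if \<sigma> \<omega> = n + 1 then 0 else X (\<sigma> \<omega>) \<omega>)
      = (\<Sum>t\<in>{1..n}. indicator {\<omega> \<in> space M. \<sigma> \<omega> = t} \<omega> * X t \<omega>)"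
    by (auto simp: sum.delta)
qed

lemma partial_reward_step:
  assumes \<sigma>: "\<sigma> \<in> policies M X n" and "s \<in> {1..n}"
  shows "partial_reward \<sigma> s
    = expectation (\<lambda>\<omega>. indicator {\<omega> \<in> space M. \<sigma> \<omega> = s} \<omega> * X s \<omega>) + partial_reward \<sigma> (Suc s)"
proof -
  have int: "integrable M (\<lambda>\<omega>. indicator {\<omega> \<in> space M. \<sigma> \<omega> = t} \<omega> * X t \<omega>)" if "t \<in> {1..n}" for t
    using integrable_real_mult_indicator[OF policy_events(1)[OF \<sigma>] integrable_X[OF that], of t]
    by (simp add: mult.commute[of "indicator _ _"])
  have "{s..n} = insert s {Suc s..n}" using assms(2) by auto
  moreover have notin: "s \<notin> {Suc s..n}" by simp
  ultimately have split: "(\<lambda>\<omega>. \<Sum>t\<in>{s..n}. indicator {\<omega> \<in> space M. \<sigma> \<omega> = t} \<omega> * X t \<omega>) =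
      (\<lambda>\<omega>. indicator {\<omega> \<in> space M. \<sigma> \<omega> = s} \<omega> * X s \<omega>
        + (\<Sum>t\<in>{Suc s..n}. indicator {\<omega> \<in> space M. \<sigma> \<omega> = t} \<omega> * X t \<omega>))"
    by (simp only: sum.insert[OF finite_atLeastAtMost notin])
  show ?thesis
    unfolding partial_reward_def split
  proof (rule Bochner_Integration.integral_add[OF int[OF assms(2)] Bochner_Integration.integrable_sum])
    fix t assume "t \<in> {Suc s..n}"
    then show "integrable M (\<lambda>\<omega>. indicator {\<omega> \<in> space M. \<sigma> \<omega> = t} \<omega> * X t \<omega>)"
      by (intro int) simp
  qed
qed

text \<open>Those who reach time \<open>s\<close> either stop there or survive to
  \<open>Suc s\<close>; \<open>v\<close> is the value granted to the survivors.\<close>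

lemma expectation_stop_or_continue:
  assumes \<sigma>: "\<sigma> \<in> policies M X n" and s: "s \<in> {1..n}"
  shows "expectation (\<lambda>\<omega>. indicator {\<omega> \<in> space M. \<sigma> \<omega> = s} \<omega> * X s \<omega>)
      + v * prob {\<omega> \<in> space M. Suc s \<le> \<sigma> \<omega>}
    = expectation (\<lambda>\<omega>. indicator {\<omega> \<in> space M. s \<le> \<sigma> \<omega>} \<omega> * (if \<sigma> \<omega> = s then X s \<omega> else v))"
proof -
  have X_int: "integrable M (\<lambda>\<omega>. indicator {\<omega> \<in> space M. \<sigma> \<omega> = s} \<omega> * X s \<omega>)"
    using integrable_real_mult_indicator[OF policy_events(1)[OF \<sigma>] integrable_X[OF s], of s]
    by (simp add: mult.commute[of "indicator _ _"])
  have event: "{\<omega> \<in> space M. Suc s \<le> \<sigma> \<omega>} \<in> events"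
    using policy_events(2)[OF \<sigma>, of "Suc s"] sets_obs_filtration_subset by auto
  have "v * prob {\<omega> \<in> space M. Suc s \<le> \<sigma> \<omega>}
      = expectation (\<lambda>\<omega>. v * indicator {\<omega> \<in> space M. Suc s \<le> \<sigma> \<omega>} \<omega>)"
    using event by simp
  moreover have "integrable M (\<lambda>\<omega>. v * indicator {\<omega> \<in> space M. Suc s \<le> \<sigma> \<omega>} \<omega>)"
    using event by (intro integrable_mult_right integrable_real_indicator) (auto simp: emeasure_eq_measure)
  ultimately have "expectation (\<lambda>\<omega>. indicator {\<omega> \<in> space M. \<sigma> \<omega> = s} \<omega> * X s \<omega>)
      + v * prob {\<omega> \<in> space M. Suc s \<le> \<sigma> \<omega>}
    = expectation (\<lambda>\<omega>. indicator {\<omega> \<in> space M. \<sigma> \<omega> = s} \<omega> * X s \<omega>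
        + v * indicator {\<omega> \<in> space M. Suc s \<le> \<sigma> \<omega>} \<omega>)"
    using X_int by simp
  also have "\<dots> = expectation (\<lambda>\<omega>. indicator {\<omega> \<in> space M. s \<le> \<sigma> \<omega>} \<omega> * (if \<sigma> \<omega> = s then X s \<omega> else v))"
    by (intro Bochner_Integration.integral_cong) (auto simp: indicator_def)
  finally show ?thesis .
qed

lemma expectation_survive_max:
  assumes \<sigma>: "\<sigma> \<in> policies M X n" and s: "s \<in> {1..n}"
  shows "expectation (\<lambda>\<omega>. indicator {\<omega> \<in> space M. s \<le> \<sigma> \<omega>} \<omega> * max (X s \<omega>) (xF - w k))
      = (xF - w (Suc k)) * prob {\<omega> \<in> space M. s \<le> \<sigma> \<omega>}"
    and "integrable M (\<lambda>\<omega>. indicator {\<omega> \<in> space M. s \<le> \<sigma> \<omega>} \<omega> * max (X s \<omega>) (xF - w k))"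
proof -
  have past: "{\<omega> \<in> space M. s \<le> \<sigma> \<omega>} \<in> sets (obs_filtration M X n (s - 1))"
    using s by (intro policy_events(2)[OF \<sigma>]) simp
  have int: "integrable M (\<lambda>\<omega>. max (X s \<omega>) (xF - w k))"
    using integrable_X[OF s] by (intro Bochner_Integration.integrable_max) auto
  have "expectation (\<lambda>\<omega>. indicator {\<omega> \<in> space M. s \<le> \<sigma> \<omega>} \<omega> * max (X s \<omega>) (xF - w k))
      = prob {\<omega> \<in> space M. s \<le> \<sigma> \<omega>} * expectation (\<lambda>\<omega>. max (X s \<omega>) (xF - w k))"
    by (rule expectation_past_times_present[OF s past _ int]) simp
  then show "expectation (\<lambda>\<omega>. indicator {\<omega> \<in> space M. s \<le> \<sigma> \<omega>} \<omega> * max (X s \<omega>) (xF - w k))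
      = (xF - w (Suc k)) * prob {\<omega> \<in> space M. s \<le> \<sigma> \<omega>}"
    by (simp add: expectation_max[OF s])
  have "{\<omega> \<in> space M. s \<le> \<sigma> \<omega>} \<in> events"
    using past sets_obs_filtration_subset by blast
  from integrable_real_mult_indicator[OF this int]
  show "integrable M (\<lambda>\<omega>. indicator {\<omega> \<in> space M. s \<le> \<sigma> \<omega>} \<omega> * max (X s \<omega>) (xF - w k))"
    by (simp add: mult.commute[of "indicator _ _"])
qed

text \<open>Induction on the number \<open>k\<close> of observations left. The induction hypothesis
  grants survivors at most \<open>xF - w k\<close>, the better of stopping and continuing bounds
  either choice, and \<open>expectation_survive_max\<close> factors its expectation.\<close>

lemma partial_reward_le:
  assumes \<sigma>: "\<sigma> \<in> policies M X n" and "k \<le> n"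
  shows "partial_reward \<sigma> (Suc n - k) \<le> (xF - w k) * prob {\<omega> \<in> space M. Suc n - k \<le> \<sigma> \<omega>}"
  using \<open>k \<le> n\<close>
proof (induction k)
  case 0
  then show ?case by (simp add: partial_reward_def w_0)
next
  case (Suc k)
  define s where "s = n - k"
  have s: "s \<in> {1..n}" "Suc n - Suc k = s" "Suc n - k = Suc s"
    using Suc.prems by (auto simp: s_def)
  have "partial_reward \<sigma> s = expectation (\<lambda>\<omega>. indicator {\<omega> \<in> space M. \<sigma> \<omega> = s} \<omega> * X s \<omega>)
      + partial_reward \<sigma> (Suc s)"
    by (rule partial_reward_step[OF \<sigma> s(1)])
  also have "\<dots> \<le> expectation (\<lambda>\<omega>. indicator {\<omega> \<in> space M. \<sigma> \<omega> = s} \<omega> * X s \<omega>)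
      + (xF - w k) * prob {\<omega> \<in> space M. Suc s \<le> \<sigma> \<omega>}"
    using Suc s by simp
  also have "\<dots> = expectation (\<lambda>\<omega>. indicator {\<omega> \<in> space M. s \<le> \<sigma> \<omega>} \<omega> *
      (if \<sigma> \<omega> = s then X s \<omega> else xF - w k))"
    by (rule expectation_stop_or_continue[OF \<sigma> s(1)])
  also have "\<dots> \<le> expectation (\<lambda>\<omega>. indicator {\<omega> \<in> space M. s \<le> \<sigma> \<omega>} \<omega> * max (X s \<omega>) (xF - w k))"
  proof (rule integral_mono_AE'[OF expectation_survive_max(2)[OF \<sigma> s(1)]])
    show "AE \<omega> in M. indicator {\<omega> \<in> space M. s \<le> \<sigma> \<omega>} \<omega> * (if \<sigma> \<omega> = s then X s \<omega> else xF - w k)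
        \<le> indicator {\<omega> \<in> space M. s \<le> \<sigma> \<omega>} \<omega> * max (X s \<omega>) (xF - w k)"
      by (intro AE_I2) (simp add: indicator_def)
    \<comment> \<open>With a nonnegative integrable majorant, the comparison of integrals asks for
      no integrability of the smaller function.\<close>
    show "AE \<omega> in M. 0 \<le> indicator {\<omega> \<in> space M. s \<le> \<sigma> \<omega>} \<omega> * max (X s \<omega>) (xF - w k)"
      using AE_X_bounds[OF s(1)] by eventually_elim (simp add: indicator_def le_max_iff_disj)
  qed
  also have "\<dots> = (xF - w (Suc k)) * prob {\<omega> \<in> space M. s \<le> \<sigma> \<omega>}"
    by (rule expectation_survive_max(1)[OF \<sigma> s(1)])
  finally show ?case using s by simp
qed

text \<open>The induction of \<open>partial_reward_le\<close> with equality throughout: accepting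
  exactly when the observation reaches the continuation value attains the maximum at every
  step.\<close>

lemma partial_reward_threshold:
  assumes \<sigma>: "\<sigma> \<in> policies M X n" and "k \<le> n"
    and threshold: "\<And>s \<omega>. s \<in> {1..n} \<Longrightarrow> \<omega> \<in> space M \<Longrightarrow> s \<le> \<sigma> \<omega> \<Longrightarrow> \<sigma> \<omega> = s \<longleftrightarrow> xF - w (n - s) \<le> X s \<omega>"
  shows "partial_reward \<sigma> (Suc n - k) = (xF - w k) * prob {\<omega> \<in> space M. Suc n - k \<le> \<sigma> \<omega>}"
  using \<open>k \<le> n\<close>
proof (induction k)
  case 0
  then show ?case by (simp add: partial_reward_def w_0)
next
  case (Suc k)
  define s where "s = n - k"
  have s: "s \<in> {1..n}" "Suc n - Suc k = s" "Suc n - k = Suc s" "n - s = k"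
    using Suc.prems by (auto simp: s_def)
  have "partial_reward \<sigma> s = expectation (\<lambda>\<omega>. indicator {\<omega> \<in> space M. \<sigma> \<omega> = s} \<omega> * X s \<omega>)
      + (xF - w k) * prob {\<omega> \<in> space M. Suc s \<le> \<sigma> \<omega>}"
    using Suc s partial_reward_step[OF \<sigma> s(1)] by simp
  also have "\<dots> = expectation (\<lambda>\<omega>. indicator {\<omega> \<in> space M. s \<le> \<sigma> \<omega>} \<omega> *
      (if \<sigma> \<omega> = s then X s \<omega> else xF - w k))"
    by (rule expectation_stop_or_continue[OF \<sigma> s(1)])
  also have "\<dots> = expectation (\<lambda>\<omega>. indicator {\<omega> \<in> space M. s \<le> \<sigma> \<omega>} \<omega> * max (X s \<omega>) (xF - w k))"
    using threshold[OF s(1)] s(4)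
    by (intro Bochner_Integration.integral_cong) (auto simp: indicator_def max_def)
  also have "\<dots> = (xF - w (Suc k)) * prob {\<omega> \<in> space M. s \<le> \<sigma> \<omega>}"
    by (rule expectation_survive_max(1)[OF \<sigma> s(1)])
  finally show ?case using s by simp
qed

section \<open>The value of an optimal rule\<close>

lemma prob_policy_ge_1:
  assumes "\<sigma> \<in> policies M X n"
  shows "prob {\<omega> \<in> space M. 1 \<le> \<sigma> \<omega>} = 1"
proof -
  have "{\<omega> \<in> space M. 1 \<le> \<sigma> \<omega>} = space M"
    using assms by (force simp: policies_def)
  then show ?thesis using prob_space by simp
qed

lemma expected_reward_le:
  assumes "\<sigma> \<in> policies M X n"
  shows "expected_reward M X n \<sigma> \<le> xF - w n"
  using partial_reward_le[OF assms, of n] prob_policy_ge_1[OF assms]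
  by (simp add: expected_reward_eq_partial_reward[OF assms])

text \<open>The alternative \<open>t = Suc n\<close> keeps the minimum well defined and encodes that
  nothing is accepted. At the last time the threshold is \<open>xF - w 0 = 0\<close>.\<close>

definition threshold_rule :: "'a \<Rightarrow> nat" where
  "threshold_rule \<omega> = (LEAST t. t = Suc n \<or> t \<in> {1..n} \<and> xF - w (n - t) \<le> X t \<omega>)"

lemma threshold_rule_le_iff:
  "threshold_rule \<omega> \<le> t \<longleftrightarrow> Suc n \<le> t \<or> (\<exists>s\<in>{1..min t n}. xF - w (n - s) \<le> X s \<omega>)"
proof -
  let ?P = "\<lambda>t. t = Suc n \<or> t \<in> {1..n} \<and> xF - w (n - t) \<le> X t \<omega>"
  have "?P (threshold_rule \<omega>)"
    unfolding threshold_rule_def by (rule LeastI[of ?P "Suc n"]) simp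
  moreover have least: "threshold_rule \<omega> \<le> s" if "?P s" for s
    unfolding threshold_rule_def using that by (rule Least_le)
  moreover have "threshold_rule \<omega> \<le> t" if "s \<in> {1..min t n}" "xF - w (n - s) \<le> X s \<omega>" for s
    using least[of s] that by simp
  moreover have "threshold_rule \<omega> \<le> t" if "Suc n \<le> t"
    using least[of "Suc n"] that by simp
  ultimately show ?thesis by auto
qed

lemma threshold_rule_range: "threshold_rule \<omega> \<in> {1..n} \<union> {n + 1}"
proof -
  let ?P = "\<lambda>t. t = Suc n \<or> t \<in> {1..n} \<and> xF - w (n - t) \<le> X t \<omega>"
  have "?P (threshold_rule \<omega>)"
    unfolding threshold_rule_def by (rule LeastI[of ?P "Suc n"]) simp
  then show ?thesis by auto
qed

lemma threshold_rule_policy: "threshold_rule \<in> policies M X n"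
proof -
  have "{\<omega> \<in> space M. threshold_rule \<omega> \<le> t} \<in> sets (obs_filtration M X n t)" for t
  proof (cases "Suc n \<le> t")
    case True
    then have "{\<omega> \<in> space M. threshold_rule \<omega> \<le> t} = space (obs_filtration M X n t)"
      by (auto simp: threshold_rule_le_iff)
    then show ?thesis by (metis sets.top)
  next
    case False
    then have "{\<omega> \<in> space M. threshold_rule \<omega> \<le> t}
        = (\<Union>s\<in>{1..min t n}. X s -` {xF - w (n - s)..} \<inter> space M)"
      by (auto simp: threshold_rule_le_iff)
    also have "\<dots> \<in> sets (obs_filtration M X n t)"
    proof (intro sets.finite_UN finite_atLeastAtMost)
      fix s assume "s \<in> {1..min t n}"
      then show "X s -` {xF - w (n - s)..} \<inter> space M \<in> sets (obs_filtration M X n t)"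
        unfolding sets_obs_filtration by (intro sigma_sets.Basic UN_I[of s]) (auto intro!: exI[of _ "{xF - w (n - s)..}"])
    qed
    finally show ?thesis .
  qed
  then show ?thesis
    using threshold_rule_range by (simp add: policies_def stopping_time_def pred_def)
qed

lemma expected_reward_threshold_rule: "expected_reward M X n threshold_rule = xF - w n"
proof -
  have "threshold_rule \<omega> = s \<longleftrightarrow> xF - w (n - s) \<le> X s \<omega>"
    if "s \<in> {1..n}" "s \<le> threshold_rule \<omega>" for s \<omega>
  proof
    assume "threshold_rule \<omega> = s"
    then have "s = Suc n \<or> s \<in> {1..n} \<and> xF - w (n - s) \<le> X s \<omega>"
      using LeastI[of "\<lambda>t. t = Suc n \<or> t \<in> {1..n} \<and> xF - w (n - t) \<le> X t \<omega>" "Suc n"]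
      by (simp add: threshold_rule_def)
    then show "xF - w (n - s) \<le> X s \<omega>" using that by auto
  next
    assume "xF - w (n - s) \<le> X s \<omega>"
    then have "threshold_rule \<omega> \<le> s"
      using that by (auto simp: threshold_rule_le_iff)
    then show "threshold_rule \<omega> = s" using that by simp
  qed
  then show ?thesis
    using partial_reward_threshold[OF threshold_rule_policy, of n] prob_policy_ge_1[OF threshold_rule_policy]
    by (simp add: expected_reward_eq_partial_reward[OF threshold_rule_policy])
qed

lemma optimal_rule_threshold_rule: "optimal_rule M X n threshold_rule"
  using threshold_rule_policy expected_reward_le
  by (simp add: optimal_rule_def expected_reward_threshold_rule)

lemma expected_reward_optimal_rule:
  assumes "optimal_rule M X n \<tau>"
  shows "expected_reward M X n \<tau> = xF - w n"
  using assms expected_reward_le threshold_rule_policy expected_reward_threshold_rule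
  unfolding optimal_rule_def by (metis order_antisym)

end

section \<open>The exponential-type family\<close>

lemma integral_reflect_interval:
  fixes g :: "real \<Rightarrow> real"
  shows "(\<integral>x. indicator {b - l..b} x * g x \<partial>lborel) = (\<integral>y. indicator {0..l} y * g (b - y) \<partial>lborel)"
proof -
  have "(\<integral>x. indicator {b - l..b} x * g x \<partial>lborel)
      = \<bar>- 1\<bar> *\<^sub>R (\<integral>y. indicator {b - l..b} (b + - 1 * y) * g (b + - 1 * y) \<partial>lborel)"
    by (rule lborel_integral_real_affine) simp
  also have "(\<lambda>y. indicator {b - l..b} (b + - 1 * y) * g (b + - 1 * y)) = (\<lambda>y. indicator {0..l} y * g (b - y))"
    by (auto simp: fun_eq_iff indicator_def)
  finally show ?thesis by simp
qed

lemma exp_type_familyD: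
  assumes "exp_type_family \<theta> x0 (ereal xF) \<phi>"
  shows "0 < \<theta>" "0 \<le> x0" "x0 < xF" "\<phi> x0 = 0"
    "strict_mono_on {x0..<xF} \<phi>" "bij_betw \<phi> {x0..<xF} {0..}"
proof -
  have "supp x0 (ereal xF) = {x0..<xF}" by (auto simp: supp_def)
  then show "0 < \<theta>" "0 \<le> x0" "x0 < xF" "\<phi> x0 = 0"
    "strict_mono_on {x0..<xF} \<phi>" "bij_betw \<phi> {x0..<xF} {0..}"
    using assms by (auto simp: exp_type_family_def)
qed

lemma psi_inverse:
  assumes "exp_type_family \<theta> x0 (ereal xF) \<phi>" "0 \<le> y"
  shows "psi x0 (ereal xF) \<phi> y \<in> {x0..<xF}" "\<phi> (psi x0 (ereal xF) \<phi> y) = y"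
proof -
  have supp: "supp x0 (ereal xF) = {x0..<xF}" by (auto simp: supp_def)
  have y: "y \<in> \<phi> ` {x0..<xF}"
    using bij_betw_imp_surj_on[OF exp_type_familyD(6)[OF assms(1)]] assms(2) by simp
  show "psi x0 (ereal xF) \<phi> y \<in> {x0..<xF}"
    unfolding psi_def supp by (rule inv_into_into[OF y])
  show "\<phi> (psi x0 (ereal xF) \<phi> y) = y"
    unfolding psi_def supp by (rule f_inv_into_f[OF y])
qed

lemma less_psi:
  assumes fam: "exp_type_family \<theta> x0 (ereal xF) \<phi>" and "x \<in> {x0..<xF}" "\<phi> x < y" "0 \<le> y"
  shows "x < psi x0 (ereal xF) \<phi> y"
proof (rule ccontr)
  assume "\<not> x < psi x0 (ereal xF) \<phi> y"
  then have "\<phi> (psi x0 (ereal xF) \<phi> y) \<le> \<phi> x"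
    using psi_inverse(1)[OF fam \<open>0 \<le> y\<close>] assms(2)
      strict_mono_onD[OF exp_type_familyD(5)[OF fam], of "psi x0 (ereal xF) \<phi> y" x]
    by (cases "psi x0 (ereal xF) \<phi> y = x") auto
  then show False
    using assms(3) psi_inverse(2)[OF fam \<open>0 \<le> y\<close>] by simp
qed

lemma psi_mono:
  assumes fam: "exp_type_family \<theta> x0 (ereal xF) \<phi>" and "0 \<le> y" "y \<le> z"
  shows "psi x0 (ereal xF) \<phi> y \<le> psi x0 (ereal xF) \<phi> z"
proof (cases "y = z")
  case False
  then show ?thesis
    using less_psi[OF fam psi_inverse(1)[OF fam \<open>0 \<le> y\<close>], of z] psi_inverse(2)[OF fam \<open>0 \<le> y\<close>] assms by simp
qed simp

lemma exp_type_cdf_bounds: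
  assumes "exp_type_family \<theta> x0 (ereal xF) \<phi>"
  shows "0 \<le> exp_type_cdf \<theta> x0 (ereal xF) \<phi> x" "exp_type_cdf \<theta> x0 (ereal xF) \<phi> x \<le> 1"
proof -
  have "0 \<le> \<phi> x" if "x \<in> {x0..<xF}"
    using bij_betwE[OF exp_type_familyD(6)[OF assms]] that by auto
  then show "0 \<le> exp_type_cdf \<theta> x0 (ereal xF) \<phi> x" "exp_type_cdf \<theta> x0 (ereal xF) \<phi> x \<le> 1"
    using exp_type_familyD(1)[OF assms] by (auto simp: exp_type_cdf_def)
qed

lemma exp_type_cdf_mono:
  assumes fam: "exp_type_family \<theta> x0 (ereal xF) \<phi>" and "x \<le> y"
  shows "exp_type_cdf \<theta> x0 (ereal xF) \<phi> x \<le> exp_type_cdf \<theta> x0 (ereal xF) \<phi> y"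
proof -
  consider "x < x0" | "xF \<le> y" | "x0 \<le> x" "x < y" "y < xF" | "x = y"
    using \<open>x \<le> y\<close> by linarith
  then show ?thesis
  proof cases
    case 1
    then have "exp_type_cdf \<theta> x0 (ereal xF) \<phi> x = 0" by (simp add: exp_type_cdf_def)
    then show ?thesis using exp_type_cdf_bounds(1)[OF fam] by simp
  next
    case 2
    then have "exp_type_cdf \<theta> x0 (ereal xF) \<phi> y = 1"
      using exp_type_familyD(3)[OF fam] by (simp add: exp_type_cdf_def)
    then show ?thesis using exp_type_cdf_bounds(2)[OF fam] by simp
  next
    case 3
    then have "\<phi> x < \<phi> y"
      by (intro strict_mono_onD[OF exp_type_familyD(5)[OF fam]]) auto
    then show ?thesis
      using 3 exp_type_familyD(1)[OF fam] by (simp add: exp_type_cdf_def)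
  qed simp
qed

lemma endpoint_law_exp_type:
  assumes fam: "exp_type_family \<theta> x0 (ereal xF) \<phi>" and reg: "bounded_endpoint_regular x0 xF \<phi> c c'"
  shows "endpoint_law \<theta> c xF (psi_bar x0 xF \<phi>) (\<lambda>y. 1 - exp_type_cdf \<theta> x0 (ereal xF) \<phi> (xF - y))"
proof
  note D = exp_type_familyD[OF fam]
  show "0 < \<theta>" by (rule D)
  show "0 \<le> c" "((\<lambda>y. deriv (psi_bar x0 xF \<phi>) y / psi_bar x0 xF \<phi> y) \<longlongrightarrow> - c) at_top"
    using reg by (auto simp: bounded_endpoint_regular_def Let_def)
  have "\<forall>\<^sub>F y in at_top. psi x0 (ereal xF) \<phi> differentiable (at y)"
    using reg by (auto simp: bounded_endpoint_regular_def Let_def elim: eventually_mono)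
  then show "\<forall>\<^sub>F y in at_top. psi_bar x0 xF \<phi> differentiable (at y)"
  proof eventually_elim
    case (elim y)
    have "psi_bar x0 xF \<phi> = (\<lambda>y. xF - psi x0 (ereal xF) \<phi> y)" by (simp add: fun_eq_iff psi_bar_def)
    then show ?case using elim by simp
  qed
  show "(psi_bar x0 xF \<phi> \<longlongrightarrow> 0) at_top"
  proof (rule tendstoI)
    fix e :: real assume "0 < e"
    \<comment> \<open>A point of the support within \<open>e\<close> of the endpoint; every argument
      above \<open>\<phi> x\<close> is mapped by \<open>psi\<close> beyond \<open>x\<close>.\<close>
    define x where "x = max x0 (xF - e / 2)"
    have x: "x \<in> {x0..<xF}" "xF - e < x" using \<open>0 < e\<close> D(3) by (auto simp: x_def)
    show "\<forall>\<^sub>F y in at_top. dist (psi_bar x0 xF \<phi> y) 0 < e"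
      using eventually_gt_at_top[of "max 0 (\<phi> x)"]
    proof eventually_elim
      case (elim y)
      then show ?case
        using less_psi[OF fam x(1), of y] psi_inverse(1)[OF fam, of y] x(2)
        by (auto simp: psi_bar_def dist_real_def)
    qed
  qed
next
  fix y z :: real
  show "0 < psi_bar x0 xF \<phi> y" if "0 \<le> y"
    using psi_inverse(1)[OF fam that] by (simp add: psi_bar_def)
  show "psi_bar x0 xF \<phi> y \<le> xF" if "0 \<le> y"
    using psi_inverse(1)[OF fam that] exp_type_familyD(2)[OF fam] by (simp add: psi_bar_def)
  show "psi_bar x0 xF \<phi> z \<le> psi_bar x0 xF \<phi> y" if "0 \<le> y" "y \<le> z"
    using psi_mono[OF fam that] by (simp add: psi_bar_def)
  show "1 - exp_type_cdf \<theta> x0 (ereal xF) \<phi> (xF - y) \<le> 1 - exp_type_cdf \<theta> x0 (ereal xF) \<phi> (xF - z)" if "y \<le> z"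
    using exp_type_cdf_mono[OF fam, of "xF - z" "xF - y"] that by simp
  show "0 \<le> 1 - exp_type_cdf \<theta> x0 (ereal xF) \<phi> (xF - y)" "1 - exp_type_cdf \<theta> x0 (ereal xF) \<phi> (xF - y) \<le> 1"
    using exp_type_cdf_bounds[OF fam, of "xF - y"] by simp_all
next
  fix s :: real assume "0 \<le> s"
  then show "1 - exp_type_cdf \<theta> x0 (ereal xF) \<phi> (xF - psi_bar x0 xF \<phi> s) = exp (- \<theta> * s)"
    using psi_inverse[OF fam, of s] by (simp add: psi_bar_def exp_type_cdf_def)
qed

section \<open>From limits of ratios to the asymptotic expansions\<close>

lemma tendsto_ratio_imp_exact_expansion:
  fixes f g :: "nat \<Rightarrow> real"
  assumes lim: "(\<lambda>n. f n / g n) \<longlonglongrightarrow> K" and "0 < K" and "\<And>n. 1 \<le> n \<Longrightarrow> 0 < g n"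
  shows "\<exists>\<epsilon>. \<epsilon> \<longlonglongrightarrow> 0 \<and> (\<forall>n\<ge>1. f n = K * g n * (1 + \<epsilon> n))"
proof (intro exI conjI allI impI)
  have "(\<lambda>n. f n / g n / K - 1) \<longlonglongrightarrow> K / K - 1"
    using \<open>0 < K\<close> by (intro tendsto_intros lim) auto
  then show "(\<lambda>n. f n / g n / K - 1) \<longlonglongrightarrow> 0" using \<open>0 < K\<close> by simp
  show "f n = K * g n * (1 + (f n / g n / K - 1))" if "1 \<le> n" for n
    using assms(3)[OF that] \<open>0 < K\<close> by simp
qed

text \<open>Each horizon may have its own probability space. Existence of optimal rules is asserted
  as well, so that the claim about all sequences of optimal rules is not vacuous.\<close>

theorem theorem7:
  fixes \<theta> x0 xF c c' :: real
    and \<phi> :: "real \<Rightarrow> real"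
    and M :: "nat \<Rightarrow> 'a measure"
    and X :: "nat \<Rightarrow> nat \<Rightarrow> 'a \<Rightarrow> real"
  assumes family: "exp_type_family \<theta> x0 (ereal xF) \<phi>"
    and regular: "bounded_endpoint_regular x0 xF \<phi> c c'"
    and iid: "\<And>n. n \<ge> 1 \<Longrightarrow> iid_sample (M n) (X n) n (exp_type_cdf \<theta> x0 (ereal xF) \<phi>)"
  shows "(\<forall>n\<ge>1. \<exists>\<tau>. optimal_rule (M n) (X n) n \<tau>) \<and>
    (\<forall>\<tau> :: nat \<Rightarrow> 'a \<Rightarrow> nat. (\<forall>n\<ge>1. optimal_rule (M n) (X n) n (\<tau> n)) \<longrightarrow>
      (\<exists>\<epsilon> :: nat \<Rightarrow> real. \<epsilon> \<longlonglongrightarrow> 0 \<and>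
        (\<forall>\<^sub>F n in sequentially. expected_reward (M n) (X n) n (\<tau> n) =
           xF - ((\<theta> + c) / \<theta>) powr (c / \<theta>) * psi_bar x0 xF \<phi> (ln (real n) / \<theta>) * (1 + \<epsilon> n))) \<and>
      (\<exists>\<epsilon> :: nat \<Rightarrow> real. \<epsilon> \<longlonglongrightarrow> 0 \<and>
        (\<forall>\<^sub>F n in sequentially. OPT (M n) (X n) n =
           xF - Gamma (1 + c / \<theta>) * psi_bar x0 xF \<phi> (ln (real n) / \<theta>) * (1 + \<epsilon> n))) \<and>
      (\<lambda>n. psi_bar x0 xF \<phi> (ln (real n) / \<theta>)) \<longlonglongrightarrow> 0 \<and>
      (\<lambda>n. CR (M n) (X n) n (\<tau> n)) \<longlonglongrightarrow> 1)"
proof -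
  define F where "F = exp_type_cdf \<theta> x0 (ereal xF) \<phi>"
  define Q where "Q = (\<lambda>y. 1 - F (xF - y))"
  note D = exp_type_familyD[OF family]
  interpret law: endpoint_law \<theta> c xF "psi_bar x0 xF \<phi>" Q
    unfolding Q_def F_def using family regular by (rule endpoint_law_exp_type)
  have sample: "bounded_iid_sample (M n) (X n) n F xF law.loss" if "1 \<le> n" for n
  proof -
    from iid[OF that] interpret prob_space "M n" by (simp add: iid_sample_def)
    have indep: "indep_vars (\<lambda>_. borel) (X n) {1..n}"
      using iid[OF that] by (simp add: iid_sample_def)
    show ?thesis
    proof
      show "indep_vars (\<lambda>_. borel) (X n) {1..n}" by (rule indep)
      show "prob {\<omega> \<in> space (M n). X n t \<omega> \<le> x} = F x" if "t \<in> {1..n}" for t x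
      proof -
        have [measurable]: "X n t \<in> borel_measurable (M n)"
          using indep that by (auto simp: indep_vars_def)
        have "F x = cdf (distr (M n) borel (X n t)) x"
          using iid[OF \<open>1 \<le> n\<close>] that by (simp add: iid_sample_def F_def)
        also have "\<dots> = prob (X n t -` {..x} \<inter> space (M n))"
          by (simp add: cdf_def measure_distr)
        also have "X n t -` {..x} \<inter> space (M n) = {\<omega> \<in> space (M n). X n t \<omega> \<le> x}" by auto
        finally show ?thesis by simp
      qed
      show "F x = 0" if "x < 0" for x
        using that D(2) by (simp add: F_def exp_type_cdf_def)
      show "F xF = 1" using D(3) by (simp add: F_def exp_type_cdf_def)
      \<comment> \<open>The reflection \<open>x = xF - y\<close> turns the Bellman recursion for
        \<open>F\<close> into the recursion through \<open>gain\<close>: the integral of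
        \<open>1 - Q\<close> over \<open>{0..loss k}\<close>.\<close>
      show "law.loss (Suc k) = (\<integral>x. indicator {xF - law.loss k..xF} x * F x \<partial>lborel)" for k
      proof -
        have "(\<integral>x. indicator {xF - law.loss k..xF} x * F x \<partial>lborel)
            = (\<integral>y. indicator {0..law.loss k} y - indicator {0..law.loss k} y * Q y \<partial>lborel)"
          unfolding integral_reflect_interval
          by (intro Bochner_Integration.integral_cong) (auto simp: Q_def algebra_simps)
        also have "\<dots> = law.loss k - law.gain (law.loss k)"
          unfolding law.gain_def using law.loss_pos[of k]
          by (subst Bochner_Integration.integral_diff) (auto simp: less_imp_le)
        finally show ?thesis by simp
      qed
    qed (auto simp: law.loss_pos less_imp_le law.loss_le_xF)
  qed
  have optimal: "\<exists>\<tau>. optimal_rule (M n) (X n) n \<tau>" if "1 \<le> n" for n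
    using bounded_iid_sample.optimal_rule_threshold_rule[OF sample[OF that]] by blast
  have OPT: "OPT (M n) (X n) n = xF - law.prophet_loss n" if "1 \<le> n" for n
  proof -
    have "(\<integral>x. indicator {0..xF} x * F x ^ n \<partial>lborel) = law.prophet_loss n"
      using integral_reflect_interval[of xF xF "\<lambda>x. F x ^ n"]
      unfolding law.prophet_loss_def by (simp add: Q_def)
    then show ?thesis
      using bounded_iid_sample.OPT_eq[OF sample[OF that] that] by simp
  qed
  have L: "psi_bar x0 xF \<phi> (ln (real n) / \<theta>) = law.L n" for n
    by (simp add: law.L_def)
  have Gamma_pos: "0 < Gamma (1 + c / \<theta>)"
    using law.c_nonneg law.theta_pos by (intro Gamma_real_pos) (simp add: add_pos_nonneg)
  have main: "(\<exists>\<epsilon>. \<epsilon> \<longlonglongrightarrow> 0 \<and> (\<forall>\<^sub>F n in sequentially. expected_reward (M n) (X n) n (\<tau> n) =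
        xF - law.loss_const * law.L n * (1 + \<epsilon> n))) \<and>
      (\<exists>\<epsilon>. \<epsilon> \<longlonglongrightarrow> 0 \<and> (\<forall>\<^sub>F n in sequentially. OPT (M n) (X n) n =
        xF - Gamma (1 + c / \<theta>) * law.L n * (1 + \<epsilon> n))) \<and>
      law.L \<longlonglongrightarrow> 0 \<and> (\<lambda>n. CR (M n) (X n) n (\<tau> n)) \<longlonglongrightarrow> 1"
    if \<tau>: "\<forall>n\<ge>1. optimal_rule (M n) (X n) n (\<tau> n)" for \<tau>
  proof (intro conjI)
    have reward: "expected_reward (M n) (X n) n (\<tau> n) = xF - law.loss n" if "1 \<le> n" for n
      using bounded_iid_sample.expected_reward_optimal_rule[OF sample[OF that]] \<tau> that by blast
    obtain \<epsilon> where "\<epsilon> \<longlonglongrightarrow> 0" "\<forall>n\<ge>1. law.loss n = law.loss_const * law.L n * (1 + \<epsilon> n)"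
      using tendsto_ratio_imp_exact_expansion[OF law.loss_ratio_limit law.loss_const_pos law.L_pos] by blast
    then show "\<exists>\<epsilon>. \<epsilon> \<longlonglongrightarrow> 0 \<and> (\<forall>\<^sub>F n in sequentially. expected_reward (M n) (X n) n (\<tau> n) =
        xF - law.loss_const * law.L n * (1 + \<epsilon> n))"
      using reward by (auto intro!: exI[of _ \<epsilon>] eventually_sequentiallyI[of 1])
    obtain \<epsilon> where "\<epsilon> \<longlonglongrightarrow> 0"
      "\<forall>n\<ge>1. law.prophet_loss n = Gamma (1 + c / \<theta>) * law.L n * (1 + \<epsilon> n)"
      using tendsto_ratio_imp_exact_expansion[OF law.prophet_loss_ratio_limit Gamma_pos law.L_pos] by blast
    then show "\<exists>\<epsilon>. \<epsilon> \<longlonglongrightarrow> 0 \<and> (\<forall>\<^sub>F n in sequentially. OPT (M n) (X n) n =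
        xF - Gamma (1 + c / \<theta>) * law.L n * (1 + \<epsilon> n))"
      using OPT by (auto intro!: exI[of _ \<epsilon>] eventually_sequentiallyI[of 1])
    show "law.L \<longlonglongrightarrow> 0" by (rule law.L_tendsto_0)
    have "(\<lambda>n. law.prophet_loss n / law.L n * law.L n) \<longlonglongrightarrow> Gamma (1 + c / \<theta>) * 0"
      by (intro tendsto_mult law.prophet_loss_ratio_limit law.L_tendsto_0)
    then have "(\<lambda>n. law.prophet_loss n / law.L n * law.L n) \<longlonglongrightarrow> 0" by simp
    then have prophet_0: "law.prophet_loss \<longlonglongrightarrow> 0"
    proof (rule Lim_transform_eventually)
      show "\<forall>\<^sub>F n in sequentially. law.prophet_loss n / law.L n * law.L n = law.prophet_loss n"
        using law.L_pos by (intro eventually_sequentiallyI[of 1]) (simp add: less_imp_neq[symmetric])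
    qed
    \<comment> \<open>Both values tend to the same limit \<open>xF\<close>, which is positive, so
      the quotient converges.\<close>
    have "(\<lambda>n. (xF - law.loss n) / (xF - law.prophet_loss n)) \<longlonglongrightarrow> (xF - 0) / (xF - 0)"
      using law.xF_pos by (intro tendsto_intros law.loss_tendsto_0 prophet_0) auto
    then have "(\<lambda>n. (xF - law.loss n) / (xF - law.prophet_loss n)) \<longlonglongrightarrow> 1"
      using law.xF_pos by simp
    then show "(\<lambda>n. CR (M n) (X n) n (\<tau> n)) \<longlonglongrightarrow> 1"
    proof (rule Lim_transform_eventually)
      show "\<forall>\<^sub>F n in sequentially. (xF - law.loss n) / (xF - law.prophet_loss n) = CR (M n) (X n) n (\<tau> n)"
        by (intro eventually_sequentiallyI[of 1]) (simp add: CR_def reward OPT)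
    qed
  qed
  show ?thesis
    using optimal main unfolding L law.loss_const_def by blast
qed

end
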